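(* There exist positive constants $c$ and $C$ such that the following holds for $p=p(n)\in[0,1]$. 1. If $p\le c\left(\frac{\log n}{n}\right)^{1/2}$, then with high probability $\mathrm{tc}_2(G(n,n,p))\ge 4$. 2. If $p\ge C\left(\frac{\log n}{n}\right)^{1/2}$, then with high probability $G\sim G(n,n,p)$ has the following property: in every $2$-colouring of $G$, all but at most $200/p$ vertices of $G$ can be covered using at most three vertex-disjoint monochromatic trees.
   Context: $G(n,m,p)$ denotes the binomial random bipartite graph: its vertex classes are disjoint copies of $[n]$ and $[m]$, and each possible edge between the two classes appears independently with probability $p$. $\log$ is the natural logarithm. "With high probability" means with probability $1-o(1)$ as $n\to\infty$. A $2$-colouring of a graph $G$ is an arbitrary colouring of the edges of $G$ with up to $2$ colours. A monochromatic tree is a subgraph of $G$ that is a tree all of whose edges have the same colour (a single vertex counts as a monochromatic tree); different trees in a cover may have different colours. $\mathrm{tc}_2(G)$ is the smallest integer $k$ such that, in every $2$-colouring of $G$, the vertex set $V(G)$ can be covered by at most $k$ monochromatic trees (not necessarily disjoint). *)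

theory Defs
  imports "HOL-Probability.Probability" "HOL-Probability.Product_PMF"
begin

text \<open>
  Undirected simple graphs are given by a vertex set and a set of two-element edges.
  The trees of the AFP entry Graph Theory cannot be used here: that entry models undirected
  graphs as symmetric digraphs, in which every edge already forms a cycle of length two.
\<close>

type_synonym 'v graph = "'v set \<times> 'v set set"

abbreviation vertices :: "'v graph \<Rightarrow> 'v set" where
  "vertices \<equiv> fst"

abbreviation edges :: "'v graph \<Rightarrow> 'v set set" where
  "edges \<equiv> snd"

definition simple_graph :: "'v graph \<Rightarrow> bool" where
  "simple_graph G \<longleftrightarrow>
     (\<forall>e\<in>edges G. \<exists>u\<in>vertices G. \<exists>v\<in>vertices G. u \<noteq> v \<and> e = {u, v})"

definition subgraph :: "'v graph \<Rightarrow> 'v graph \<Rightarrow> bool" where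
  "subgraph H G \<longleftrightarrow> simple_graph H \<and> vertices H \<subseteq> vertices G \<and> edges H \<subseteq> edges G"

definition walk :: "'v graph \<Rightarrow> 'v list \<Rightarrow> bool" where
  "walk G xs \<longleftrightarrow>
     xs \<noteq> [] \<and> set xs \<subseteq> vertices G \<and> successively (\<lambda>u v. {u, v} \<in> edges G) xs"

definition connected_graph :: "'v graph \<Rightarrow> bool" where
  "connected_graph G \<longleftrightarrow> vertices G \<noteq> {} \<and>
     (\<forall>u\<in>vertices G. \<forall>v\<in>vertices G. \<exists>xs. walk G xs \<and> hd xs = u \<and> last xs = v)"

text \<open>The first vertex of a cycle is not repeated at the end of the list.\<close>

definition cycle :: "'v graph \<Rightarrow> 'v list \<Rightarrow> bool" where
  "cycle G xs \<longleftrightarrow> walk G xs \<and> distinct xs \<and> length xs \<ge> 3 \<and> {last xs, hd xs} \<in> edges G"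

definition tree :: "'v graph \<Rightarrow> bool" where
  "tree T \<longleftrightarrow> simple_graph T \<and> connected_graph T \<and> (\<nexists>xs. cycle T xs)"

text \<open>
  A colouring is a function on all sets of vertices; only its values on the edges matter.
  Not all \<open>r\<close> colours need to be used.
\<close>

definition edge_colouring :: "nat \<Rightarrow> 'v graph \<Rightarrow> ('v set \<Rightarrow> nat) \<Rightarrow> bool" where
  "edge_colouring r G \<phi> \<longleftrightarrow> (\<forall>e\<in>edges G. \<phi> e < r)"

definition mono_tree :: "'v graph \<Rightarrow> ('v set \<Rightarrow> nat) \<Rightarrow> 'v graph \<Rightarrow> bool" where
  "mono_tree G \<phi> T \<longleftrightarrow> subgraph T G \<and> tree T \<and> (\<exists>c. \<forall>e\<in>edges T. \<phi> e = c)"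

definition mono_tree_cover :: "'v graph \<Rightarrow> ('v set \<Rightarrow> nat) \<Rightarrow> nat \<Rightarrow> bool" where
  "mono_tree_cover G \<phi> k \<longleftrightarrow>
     (\<exists>\<T>. finite \<T> \<and> card \<T> \<le> k \<and> (\<forall>T\<in>\<T>. mono_tree G \<phi> T) \<and>
          vertices G \<subseteq> (\<Union>T\<in>\<T>. vertices T))"

definition tc :: "nat \<Rightarrow> 'v graph \<Rightarrow> nat" where
  "tc r G = (LEAST k. \<forall>\<phi>. edge_colouring r G \<phi> \<longrightarrow> mono_tree_cover G \<phi> k)"

definition almost_disjoint_cover ::
    "'v graph \<Rightarrow> ('v set \<Rightarrow> nat) \<Rightarrow> nat \<Rightarrow> real \<Rightarrow> bool" where
  "almost_disjoint_cover G \<phi> k t \<longleftrightarrow>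
     (\<exists>\<T>. finite \<T> \<and> card \<T> \<le> k \<and> (\<forall>T\<in>\<T>. mono_tree G \<phi> T) \<and>
          pairwise (\<lambda>S T. disjnt (vertices S) (vertices T)) \<T> \<and>
          real (card (vertices G - (\<Union>T\<in>\<T>. vertices T))) \<le> t)"

definition bipartite_graph :: "nat \<Rightarrow> nat \<Rightarrow> (nat \<times> nat \<Rightarrow> bool) \<Rightarrow> (nat + nat) graph" where
  "bipartite_graph n m \<omega> =
     (Inl ` {1..n} \<union> Inr ` {1..m},
      {{Inl i, Inr j} | i j. i \<in> {1..n} \<and> j \<in> {1..m} \<and> \<omega> (i, j)})"

text \<open>The binomial random bipartite graph \<open>G(n, m, p)\<close>, for \<open>0 \<le> p \<le> 1\<close>.\<close>

definition random_bipartite :: "nat \<Rightarrow> nat \<Rightarrow> real \<Rightarrow> (nat + nat) graph pmf" where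
  "random_bipartite n m p =
     map_pmf (bipartite_graph n m)
       (Pi_pmf ({1..n} \<times> {1..m}) False (\<lambda>_. bernoulli_pmf p))"

definition whp :: "(nat \<Rightarrow> 'a pmf) \<Rightarrow> (nat \<Rightarrow> 'a \<Rightarrow> bool) \<Rightarrow> bool" where
  "whp X P \<longleftrightarrow> (\<lambda>n. measure_pmf.prob (X n) {x. P n x}) \<longlonglongrightarrow> 1"

text \<open>Finite graphs can be covered by single vertices, so the minimum in \<^const>\<open>tc\<close> exists.\<close>

lemma mono_tree_single_vertex:
  assumes "v \<in> vertices G"
  shows "mono_tree G \<phi> ({v}, {})"
proof -
  have "\<exists>xs. walk ({v}, {}) xs \<and> hd xs = v \<and> last xs = v"
    by (rule exI[of _ "[v]"]) (simp add: walk_def)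
  moreover have "\<not> cycle ({v}, {}) xs" for xs
    by (simp add: cycle_def)
  ultimately show ?thesis
    using assms
    by (simp add: mono_tree_def subgraph_def tree_def simple_graph_def connected_graph_def)
qed

lemma mono_tree_cover_single_vertices:
  assumes "finite (vertices G)"
  shows "mono_tree_cover G \<phi> (card (vertices G))"
proof -
  let ?T = "(\<lambda>v. ({v}, {})) ` vertices G"
  have "finite ?T" "card ?T \<le> card (vertices G)"
    using assms by (simp_all add: card_image_le)
  moreover have "\<forall>T\<in>?T. mono_tree G \<phi> T"
    by (auto intro: mono_tree_single_vertex)
  ultimately show ?thesis
    unfolding mono_tree_cover_def by (intro exI[of _ ?T]) auto
qed

lemma tc_cover:
  assumes "finite (vertices G)" "edge_colouring r G \<phi>"
  shows "mono_tree_cover G \<phi> (tc r G)"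
proof -
  have "\<forall>\<phi>. edge_colouring r G \<phi> \<longrightarrow> mono_tree_cover G \<phi> (tc r G)"
    unfolding tc_def
    by (rule LeastI[of _ "card (vertices G)"])
       (use mono_tree_cover_single_vertices[OF assms(1)] in blast)
  then show ?thesis using assms(2) by blast
qed

end

theory Submission
  imports Defs "HOL-Real_Asymp.Real_Asymp"
begin

text \<open>
  Lower bound. If two vertices \<open>x1\<close>, \<open>x2\<close> on the left have no common neighbour, two vertices \<open>y1\<close>, \<open>y2\<close> on the
  right have none either, and no \<open>xi\<close> is adjacent to any \<open>yj\<close>, then some 2-colouring puts these four vertices
  into different components of both colours. Such pairs are found among the first \<open>n powr (1 / 5)\<close> vertices of each
  side: no edge joins these vertices with high probability, and disjoint pairs have independent neighbourhoods.

  Upper bound. With high probability, any two sets of order \<open>log n / p\<close> on different sides are joined by an edge,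
  and so are any set of order \<open>1 / p\<close> and any set of linear size. In a 2-colouring, call a vertex sparse in a
  colour if it has few edges of that colour. All but \<open>O(1 / p)\<close> of the vertices on one side that are sparse in one
  colour are connected in the other colour, through any linear set. If sparse vertices of one of the
  colours are absent on both sides, that colour has at most three components or the other one has a giant
  component that leaves over at most one tree on each side. Otherwise there are many sparse vertices for both
  colours, on the same side or on opposite sides, and their two trees leave over at most one further tree. The
  trees are made disjoint by splitting sets of common neighbours so that every large neighbourhood meets both parts.
\<close>

section \<open>Connected vertex sets\<close>

text \<open>Both bounds weigh \<open>n * p\<^sup>2\<close> against \<open>log n\<close>. Two
  vertices on one side have no common neighbour with probability \<open>(1 - p\<^sup>2) ^ n\<close>,
  which \<open>c = 1 / 4\<close> keeps above \<open>n powr (- (1 / 8))\<close>. The exponent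
  \<open>1 / 5\<close> exceeds \<open>1 / 8\<close>, so that one of the disjoint pairs succeeds, and
  its double is below \<open>1 / 2\<close>, so that the small square between the two sides has no
  edge. Above the threshold, \<open>log n / p\<^sup>2\<close> is a small fraction of
  \<open>n\<close>; this is the condition \<open>2000 * (m * s) \<le> n\<close> below. Hence
  \<open>m\<close> vertices with \<open>O(s)\<close> neighbours each in one colour reach few
  vertices in that colour, and the other colour must reach almost all the rest. The connectivity of
  the cores rests on this count. The obstacle is disjointness: a vertex that connects one tree may
  be wanted by another. Blocks of about \<open>n / 16\<close> vertices are therefore reserved for
  the inner connections of a core, and a further tree takes only vertices that would otherwise be
  leaves.\<close>

text \<open>Connectedness is expressed by cuts, so that \<^term>\<open>{}\<close> counts as connected: it stands for an unused tree.\<close>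

definition conn :: "('v \<Rightarrow> 'v \<Rightarrow> bool) \<Rightarrow> 'v set \<Rightarrow> bool" where
  "conn E W \<longleftrightarrow> (\<forall>V\<subseteq>W. V \<noteq> {} \<longrightarrow> V \<noteq> W \<longrightarrow> (\<exists>x\<in>V. \<exists>y\<in>W - V. E x y))"

lemma conn_empty [simp]: "conn E {}"
  by (auto simp: conn_def)

lemma conn_attach:
  assumes sym: "\<And>x y. E x y \<Longrightarrow> E y x" and W: "conn E W"
    and Y: "\<And>y. y \<in> Y \<Longrightarrow> \<exists>w\<in>W. E w y"
  shows "conn E (W \<union> Y)"
  unfolding conn_def
proof (intro allI impI)
  fix V assume V: "V \<subseteq> W \<union> Y" "V \<noteq> {}" "V \<noteq> W \<union> Y"
  consider "V \<inter> W = {}" | "V \<inter> W = W" | "V \<inter> W \<noteq> {}" "V \<inter> W \<noteq> W" by blast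
  then show "\<exists>x\<in>V. \<exists>y\<in>W \<union> Y - V. E x y"
  proof cases
    case 1
    then obtain v where "v \<in> V" "v \<in> Y" using V by blast
    then show ?thesis using Y[of v] 1 sym by blast
  next
    case 2
    then obtain y where "y \<in> Y" "y \<notin> V" using V by blast
    then show ?thesis using Y[of y] 2 by blast
  next
    case 3
    have "\<exists>x\<in>V \<inter> W. \<exists>y\<in>W - V \<inter> W. E x y"
      using W 3 unfolding conn_def by blast
    then show ?thesis by blast
  qed
qed

lemma conn_attach_subset:
  assumes sym: "\<And>x y. E x y \<Longrightarrow> E y x" and W: "conn E W" and "W \<subseteq> U"
    and Y: "\<And>y. y \<in> U \<Longrightarrow> y \<notin> W \<Longrightarrow> \<exists>w\<in>W. E w y"
  shows "conn E U"
proof -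
  have "conn E (W \<union> (U - W))"
    by (rule conn_attach[OF sym W]) (use Y in auto)
  moreover have "W \<union> (U - W) = U" using assms(3) by blast
  ultimately show ?thesis by simp
qed

lemma conn_join:
  assumes sym: "\<And>x y. E x y \<Longrightarrow> E y x" and "conn E W1" "conn E W2"
    and e: "x \<in> W1" "y \<in> W2" "E x y"
  shows "conn E (W1 \<union> W2)"
  unfolding conn_def
proof (intro allI impI)
  fix V assume V: "V \<subseteq> W1 \<union> W2" "V \<noteq> {}" "V \<noteq> W1 \<union> W2"
  have cut: "\<exists>x\<in>V. \<exists>y\<in>W1 \<union> W2 - V. E x y"
    if "W \<subseteq> W1 \<union> W2" "conn E W" "V \<inter> W \<noteq> {}" "V \<inter> W \<noteq> W" for W
  proof -
    have "\<exists>x\<in>V \<inter> W. \<exists>y\<in>W - V \<inter> W. E x y"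
      using that unfolding conn_def by blast
    then show ?thesis using that(1) by blast
  qed
  show "\<exists>x\<in>V. \<exists>y\<in>W1 \<union> W2 - V. E x y"
  proof (rule ccontr)
    assume neg: "\<not> ?thesis"
    have "V \<inter> W1 = {} \<or> V \<inter> W1 = W1" "V \<inter> W2 = {} \<or> V \<inter> W2 = W2"
      using cut[of W1] cut[of W2] assms(2,3) neg by blast+
    then show False using V neg e sym by blast
  qed
qed

lemma conn_component:
  fixes E :: "'v \<Rightarrow> 'v \<Rightarrow> bool"
  assumes E: "\<And>x y. E x y \<Longrightarrow> E y x"
  shows "conn E {y. E\<^sup>*\<^sup>* x y}"
  unfolding conn_def
proof (intro allI impI, rule ccontr)
  fix V assume V: "V \<subseteq> {y. E\<^sup>*\<^sup>* x y}" "V \<noteq> {}" "V \<noteq> {y. E\<^sup>*\<^sup>* x y}"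
    and neg: "\<not> (\<exists>u\<in>V. \<exists>y\<in>{y. E\<^sup>*\<^sup>* x y} - V. E u y)"
  have "y \<in> V \<longleftrightarrow> x \<in> V" if "E\<^sup>*\<^sup>* x y" for y
    using that
  proof (induction rule: rtranclp_induct)
    case (step y z)
    then have "E\<^sup>*\<^sup>* x z" by simp
    then show ?case using step neg E by blast
  qed simp
  then show False using V by auto
qed

lemma conn_mono: "conn E W \<Longrightarrow> (\<And>x y. E x y \<Longrightarrow> E' x y) \<Longrightarrow> conn E' W"
  unfolding conn_def by meson

lemma at_most_three:
  assumes "finite \<C>" "card \<C> \<le> 3" "\<And>C D. C \<in> \<C> \<Longrightarrow> D \<in> \<C> \<Longrightarrow> C \<noteq> D \<Longrightarrow> C \<inter> D = {}"
  obtains W1 W2 W3 where "{W1, W2, W3} \<subseteq> insert {} \<C>" "W1 \<inter> W2 = {}" "W1 \<inter> W3 = {}" "W2 \<inter> W3 = {}"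
    "\<Union>\<C> = W1 \<union> W2 \<union> W3"
proof -
  consider "\<C> = {}" | "card \<C> = 1" | "card \<C> = 2" | "card \<C> = 3"
    using assms(1,2) by (cases "card \<C>") (auto simp: numeral_3_eq_3 le_Suc_eq)
  then show thesis
  proof cases
    case 1 then show ?thesis using that[of "{}" "{}" "{}"] by simp
  next
    case 2
    then obtain C where "\<C> = {C}" using card_1_singletonE by blast
    then show ?thesis using that[of C "{}" "{}"] by simp
  next
    case 3
    then obtain C D where "\<C> = {C, D}" "C \<noteq> D" by (meson card_2_iff)
    then show ?thesis using that[of C D "{}"] assms(3) by simp
  next
    case 4
    then obtain C D F where "\<C> = {C, D, F}" "C \<noteq> D" "D \<noteq> F" "C \<noteq> F" by (metis card_3_iff)
    then show ?thesis using that[of C D F] assms(3) by (simp add: Un_assoc)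
  qed
qed

section \<open>Growing trees inside connected vertex sets\<close>

lemma walk_mono:
  assumes "walk G xs" "vertices G \<subseteq> vertices H" "edges G \<subseteq> edges H"
  shows "walk H xs"
proof -
  have "successively (\<lambda>u v. {u, v} \<in> edges G) xs" using assms by (simp add: walk_def)
  then have "successively (\<lambda>u v. {u, v} \<in> edges H) xs"
    by (rule successively_mono) (use assms in blast)
  then show ?thesis using assms by (auto simp: walk_def)
qed

lemma tree_add_leaf:
  assumes T: "tree T" and u: "u \<in> vertices T" and v: "v \<notin> vertices T"
  shows "tree (insert v (vertices T), insert {u, v} (edges T))" (is "tree ?T")
proof -
  have simple: "simple_graph T" and con: "connected_graph T" and acyc: "\<nexists>xs. cycle T xs"
    using T by (auto simp: tree_def)
  have "u \<noteq> v" using u v by blast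
  have vE: "e \<in> edges T \<Longrightarrow> v \<notin> e" for e
    using simple v unfolding simple_graph_def by fastforce
  have nbr: "w = u" if "{v, w} \<in> edges ?T \<or> {w, v} \<in> edges ?T" for w
    using that vE \<open>u \<noteq> v\<close> by (auto simp: doubleton_eq_iff)
  have 1: "simple_graph ?T"
    unfolding simple_graph_def
  proof
    fix e assume "e \<in> edges ?T"
    then consider "e = {u, v}" | "e \<in> edges T" by auto
    then show "\<exists>u\<in>vertices ?T. \<exists>v\<in>vertices ?T. u \<noteq> v \<and> e = {u, v}"
    proof cases
      case 1 then show ?thesis using u \<open>u \<noteq> v\<close> by auto
    next
      case 2
      then obtain a b where "a \<in> vertices T" "b \<in> vertices T" "a \<noteq> b" "e = {a, b}"
        using simple unfolding simple_graph_def by blast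
      then show ?thesis by auto
    qed
  qed
  have old: "\<exists>xs. walk ?T xs \<and> hd xs = a \<and> last xs = b" if "a \<in> vertices T" "b \<in> vertices T" for a b
  proof -
    from con that have "\<exists>xs. walk T xs \<and> hd xs = a \<and> last xs = b" by (simp add: connected_graph_def)
    then obtain xs where "walk T xs" "hd xs = a" "last xs = b" by blast
    then show ?thesis using walk_mono[of T xs ?T] by (metis fst_conv snd_conv subset_insertI)
  qed
  have 2: "connected_graph ?T"
    unfolding connected_graph_def
  proof (intro conjI ballI)
    fix a b assume ab: "a \<in> vertices ?T" "b \<in> vertices ?T"
    consider "a = v" "b = v" | "a = v" "b \<in> vertices T" | "a \<in> vertices T" "b = v"
      | "a \<in> vertices T" "b \<in> vertices T" using ab by auto
    then show "\<exists>xs. walk ?T xs \<and> hd xs = a \<and> last xs = b"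
    proof cases
      case 1 then show ?thesis by (intro exI[of _ "[v]"]) (auto simp: walk_def)
    next
      case 2
      then obtain xs where xs: "walk ?T xs" "hd xs = u" "last xs = b" using old u by blast
      then have "walk ?T (v # xs)"
        unfolding walk_def by (cases xs) (auto simp: insert_commute)
      then show ?thesis using xs 2 by (intro exI[of _ "v # xs"]) (auto simp: walk_def)
    next
      case 3
      then obtain xs where xs: "walk ?T xs" "hd xs = a" "last xs = u" using old u by blast
      then have "walk ?T (xs @ [v])"
        unfolding walk_def by (auto simp: successively_append_iff)
      then show ?thesis using xs 3 by (intro exI[of _ "xs @ [v]"]) (auto simp: walk_def)
    next
      case 4 then show ?thesis by (rule old)
    qed
  qed simp
  have 3: "\<not> cycle ?T xs" for xs
  proof
    assume c: "cycle ?T xs"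
    then have w: "walk ?T xs" and d: "distinct xs" and len: "length xs \<ge> 3" and cl: "{last xs, hd xs} \<in> edges ?T"
      by (auto simp: cycle_def)
    have suc: "successively (\<lambda>a b. {a, b} \<in> edges ?T) xs" and ne: "xs \<noteq> []"
      using w by (auto simp: walk_def)
    show False
    proof (cases "v \<in> set xs")
      case False
      have "successively (\<lambda>a b. {a, b} \<in> edges T) xs"
        by (rule successively_mono[OF suc]) (use False in \<open>auto simp: doubleton_eq_iff\<close>)
      moreover have "{last xs, hd xs} \<in> edges T" 
        using cl False ne by (auto simp: doubleton_eq_iff)
      moreover have "set xs \<subseteq> vertices T" using w False by (auto simp: walk_def)
      ultimately have "cycle T xs" using d len ne by (auto simp: cycle_def walk_def)
      then show False using acyc by blast
    next
      case True
      then obtain ys zs where xs: "xs = ys @ v # zs" by (meson split_list)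
      have len2: "length (zs @ ys) \<ge> 2" using len xs by simp
      \<comment> \<open>\<open>zs @ ys\<close> is the cycle without \<open>v\<close>, rotated to
        start behind \<open>v\<close>. Its ends are the neighbours of \<open>v\<close> on the cycle,
        so both are \<open>u\<close>, although the list is distinct and has at least two
        entries.\<close>
      have "hd (zs @ ys) = u"
      proof (rule nbr, cases "zs = []")
        case True
        then show "{v, hd (zs @ ys)} \<in> edges ?T \<or> {hd (zs @ ys), v} \<in> edges ?T"
          using cl len2 unfolding xs by (cases ys) auto
      next
        case False
        then show "{v, hd (zs @ ys)} \<in> edges ?T \<or> {hd (zs @ ys), v} \<in> edges ?T"
          using suc unfolding xs by (cases zs) (simp_all add: successively_append_iff)
      qed
      moreover have "last (zs @ ys) = u"
      proof (rule nbr, cases "ys = []")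
        case True
        then show "{v, last (zs @ ys)} \<in> edges ?T \<or> {last (zs @ ys), v} \<in> edges ?T"
          using cl len2 unfolding xs by (cases zs) auto
      next
        case False
        then show "{v, last (zs @ ys)} \<in> edges ?T \<or> {last (zs @ ys), v} \<in> edges ?T"
          using suc unfolding xs by (simp add: successively_append_iff)
      qed
      moreover have "distinct (zs @ ys)" using d xs by auto
      ultimately show False using len2
        by (cases "zs @ ys") (auto split: if_splits dest: last_in_set)
    qed
  qed
  show ?thesis using 1 2 3 unfolding tree_def by blast
qed

text \<open>A spanning tree is grown from a single vertex. The cut between the current tree and the
  rest of \<open>W\<close> yields the next leaf directly; this is the benefit of formulating
  \<open>conn\<close> by cuts.\<close>

lemma conn_imp_mono_tree:
  assumes G: "simple_graph G" and W: "W \<subseteq> vertices G" "finite W" "W \<noteq> {}"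
    and c: "conn (\<lambda>u v. {u, v} \<in> edges G \<and> \<phi> {u, v} = c) W"
  shows "\<exists>T. mono_tree G \<phi> T \<and> vertices T = W"
proof -
  have grow: "\<exists>T'. subgraph T' G \<and> tree T' \<and> (\<forall>e\<in>edges T'. \<phi> e = c) \<and> vertices T' = W"
    if "subgraph T G" "tree T" "\<forall>e\<in>edges T. \<phi> e = c" "vertices T \<subseteq> W" for T
    using that
  proof (induction "card (W - vertices T)" arbitrary: T rule: less_induct)
    case less
    show ?case
    proof (cases "vertices T = W")
      case True
      then show ?thesis using less.prems by blast
    next
      case False
      have "vertices T \<noteq> {}" using less.prems(2) by (auto simp: tree_def connected_graph_def)
      with c False less.prems(4) obtain u v where uv: "u \<in> vertices T" "v \<in> W - vertices T"
        "{u, v} \<in> edges G" "\<phi> {u, v} = c" unfolding conn_def by blast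
      let ?T = "(insert v (vertices T), insert {u, v} (edges T))"
      have t: "tree ?T" using tree_add_leaf[OF less.prems(2)] uv by blast
      have "card (W - insert v (vertices T)) < card (W - vertices T)"
        by (rule psubset_card_mono) (use uv W in auto)
      moreover have "subgraph ?T G"
        using less.prems(1) uv W t by (auto simp: subgraph_def tree_def)
      ultimately show ?thesis
        using less.hyps[of ?T] t less.prems uv by auto
    qed
  qed
  obtain w where w: "w \<in> W" using W by blast
  have "mono_tree G \<phi> ({w}, {})" by (rule mono_tree_single_vertex) (use w W in auto)
  then have "\<exists>T'. subgraph T' G \<and> tree T' \<and> (\<forall>e\<in>edges T'. \<phi> e = c) \<and> vertices T' = W"
    by (intro grow[of "({w}, {})"]) (use w in \<open>auto simp: mono_tree_def\<close>)
  then show ?thesis by (auto simp: mono_tree_def)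
qed

section \<open>Two-coloured bipartite graphs\<close>

text \<open>Counting form of the random 2-colouring argument: \<open>F\<close> spoils only those
  \<open>P\<close> that avoid it or contain it, at most \<open>2 * 2 ^ (card U - card F)\<close> of
  the \<open>2 ^ card U\<close> candidates. By the bound on \<open>card \<F>\<close> the spoilt sets
  do not exhaust \<open>Pow U\<close>.\<close>

lemma property_B:
  fixes U :: "'a set"
  assumes U: "finite U" and fin: "finite \<F>"
    and sub: "\<And>F. F \<in> \<F> \<Longrightarrow> F \<subseteq> U" and L: "\<And>F. F \<in> \<F> \<Longrightarrow> L \<le> card F"
    and small: "2 * card \<F> < 2 ^ L"
  shows "\<exists>P\<subseteq>U. \<forall>F\<in>\<F>. F \<inter> P \<noteq> {} \<and> F - P \<noteq> {}"
proof (rule ccontr)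
  assume neg: "\<not> ?thesis"
  define Bad where "Bad F = Pow (U - F) \<union> (\<lambda>Q. Q \<union> F) ` Pow (U - F)" for F
  have fB: "finite (Bad F)" for F using U by (simp add: Bad_def)
  have "Pow U \<subseteq> (\<Union>F\<in>\<F>. Bad F)"
  proof
    fix P assume "P \<in> Pow U"
    then obtain F where F: "F \<in> \<F>" "F \<inter> P = {} \<or> F - P = {}" using neg by blast
    have "P \<in> Bad F"
    proof (cases "F \<inter> P = {}")
      case True then show ?thesis using \<open>P \<in> Pow U\<close> by (auto simp: Bad_def)
    next
      case False
      then have "P = (P - F) \<union> F" using F by blast
      moreover have "P - F \<in> Pow (U - F)" using \<open>P \<in> Pow U\<close> by blast
      ultimately show ?thesis unfolding Bad_def by blast
    qed
    then show "P \<in> (\<Union>F\<in>\<F>. Bad F)" using F by blast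
  qed
  then have le: "2 ^ card U \<le> card (\<Union>F\<in>\<F>. Bad F)"
    using card_mono[of "\<Union>F\<in>\<F>. Bad F" "Pow U"] fB fin U by (simp add: card_Pow)
  have bF: "card (Bad F) * 2 ^ L \<le> 2 * 2 ^ card U" if "F \<in> \<F>" for F
  proof -
    have fF: "finite F" "F \<subseteq> U" using sub[OF that] U finite_subset by auto
    have c: "card (U - F) = card U - card F" "card F \<le> card U"
      using fF U by (auto simp: card_Diff_subset card_mono)
    have "card (Bad F) \<le> card (Pow (U - F)) + card ((\<lambda>Q. Q \<union> F) ` Pow (U - F))"
      unfolding Bad_def by (rule card_Un_le)
    also have "\<dots> \<le> 2 * 2 ^ (card U - card F)"
      using card_image_le[of "Pow (U - F)" "\<lambda>Q. Q \<union> F"] U c by (simp add: card_Pow)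
    finally have "card (Bad F) * 2 ^ L \<le> 2 * 2 ^ (card U - card F) * 2 ^ card F"
      using L[OF that] by (intro mult_mono power_increasing) auto
    also have "\<dots> = 2 * 2 ^ card U" using c by (simp flip: power_add)
    finally show ?thesis .
  qed
  have "2 ^ card U * 2 ^ L \<le> (\<Sum>F\<in>\<F>. card (Bad F)) * 2 ^ L"
    using le card_UN_le[OF fin, of Bad] by (intro mult_right_mono) auto
  also have "\<dots> \<le> (\<Sum>F\<in>\<F>. 2 * 2 ^ card U)"
    unfolding sum_distrib_right by (rule sum_mono) (use bF in auto)
  also have "\<dots> = 2 * card \<F> * 2 ^ card U" by simp
  also have "\<dots> < 2 ^ L * 2 ^ card U" using small by simp
  finally show False by (simp add: mult.commute)
qed

text \<open>
  \<open>R\<close> and \<open>T\<close> are the two colour classes. In the application \<open>m\<close> is of order \<open>1 / p\<close>, \<open>s\<close> of order \<open>log n / p\<close>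
  and \<open>L\<close> of order \<open>log n\<close>. Interchanging the sides or the colours gives another instance, which is how
  the symmetric cases are obtained.
\<close>

locale two_coloured =
  fixes A B :: "'v set" and R T :: "'v \<Rightarrow> 'v \<Rightarrow> bool" and n m s L :: nat
  assumes finA: "finite A" and finB: "finite B" and disj: "A \<inter> B = {}"
    and cardA: "card A = n" and cardB: "card B = n"
    and symR: "\<And>x y. R x y \<Longrightarrow> R y x" and symT: "\<And>x y. T x y \<Longrightarrow> T y x"
    and edge_s: "\<And>X Y. X \<subseteq> A \<Longrightarrow> Y \<subseteq> B \<Longrightarrow> s \<le> card X \<Longrightarrow> s \<le> card Y \<Longrightarrow> \<exists>x\<in>X. \<exists>y\<in>Y. R x y \<or> T x y"
    and edgeA: "\<And>X Y. X \<subseteq> A \<Longrightarrow> Y \<subseteq> B \<Longrightarrow> m \<le> card X \<Longrightarrow> n \<le> 34 * card Y \<Longrightarrow> \<exists>x\<in>X. \<exists>y\<in>Y. R x y \<or> T x y"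
    and edgeB: "\<And>X Y. X \<subseteq> A \<Longrightarrow> Y \<subseteq> B \<Longrightarrow> n \<le> 34 * card X \<Longrightarrow> m \<le> card Y \<Longrightarrow> \<exists>x\<in>X. \<exists>y\<in>Y. R x y \<or> T x y"
    and m_pos: "0 < m" and ms: "7 * m \<le> s" and Ls: "L \<le> s" and sn: "2000 * (m * s) \<le> n"
    and nL: "8 * n < 2 ^ L"
begin

section \<open>Symmetries of the setting and covers by three connected sets\<close>

lemma swap_sides: "two_coloured B A R T n m s L"
proof
  show "\<exists>x\<in>X. \<exists>y\<in>Y. R x y \<or> T x y" if "X \<subseteq> B" "Y \<subseteq> A" "s \<le> card X" "s \<le> card Y" for X Y
    using edge_s[of Y X] that symR symT by blast
  show "\<exists>x\<in>X. \<exists>y\<in>Y. R x y \<or> T x y" if "X \<subseteq> B" "Y \<subseteq> A" "m \<le> card X" "n \<le> 34 * card Y" for X Y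
    using edgeB[of Y X] that symR symT by blast
  show "\<exists>x\<in>X. \<exists>y\<in>Y. R x y \<or> T x y" if "X \<subseteq> B" "Y \<subseteq> A" "n \<le> 34 * card X" "m \<le> card Y" for X Y
    using edgeA[of Y X] that symR symT by blast
qed (use finA finB disj cardA cardB symR symT m_pos ms Ls sn nL in auto)

lemma swap_colours: "two_coloured A B T R n m s L"
proof
  show "\<exists>x\<in>X. \<exists>y\<in>Y. T x y \<or> R x y" if "X \<subseteq> A" "Y \<subseteq> B" "s \<le> card X" "s \<le> card Y" for X Y
    using edge_s[of X Y] that by blast
  show "\<exists>x\<in>X. \<exists>y\<in>Y. T x y \<or> R x y" if "X \<subseteq> A" "Y \<subseteq> B" "m \<le> card X" "n \<le> 34 * card Y" for X Y
    using edgeA[of X Y] that by blast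
  show "\<exists>x\<in>X. \<exists>y\<in>Y. T x y \<or> R x y" if "X \<subseteq> A" "Y \<subseteq> B" "n \<le> 34 * card X" "m \<le> card Y" for X Y
    using edgeB[of X Y] that by blast
qed (use finA finB disj cardA cardB symR symT m_pos ms Ls sn nL in auto)

lemma numeric: "7 \<le> s" "2000 * m \<le> n" "2000 * s \<le> n" "0 < n" "0 < L" "n \<ge> 14000"
proof -
  show s7: "7 \<le> s" using ms m_pos by linarith
  have "m * 7 \<le> m * s" using s7 by simp
  moreover have "1 * s \<le> m * s" using m_pos by (intro mult_right_mono) auto
  moreover have "m \<le> m * s" using s7 by simp
  ultimately show a: "2000 * m \<le> n" "2000 * s \<le> n" using sn by linarith+
  show "n \<ge> 14000" using a(2) s7 by linarith
  then show "0 < n" by simp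
  with nL show "0 < L" by (cases L) auto
qed

text \<open>The allowance \<open>8 * m\<close> is dictated by the case of at most three components,
  where up to \<open>4 * m\<close> sparse vertices are discarded on each side. The other cases lose
  at most \<open>6 * m\<close> vertices.\<close>

definition three_cover :: bool where
  "three_cover \<longleftrightarrow> (\<exists>W1 W2 W3. W1 \<inter> W2 = {} \<and> W1 \<inter> W3 = {} \<and> W2 \<inter> W3 = {} \<and>
     W1 \<union> W2 \<union> W3 \<subseteq> A \<union> B \<and> (\<forall>W\<in>{W1, W2, W3}. conn R W \<or> conn T W) \<and>
     card (A \<union> B - (W1 \<union> W2 \<union> W3)) \<le> 8 * m)"

lemma three_coverI:
  assumes "W1 \<inter> W2 = {}" "W1 \<inter> W3 = {}" "W2 \<inter> W3 = {}"
    "W1 \<subseteq> A \<union> B" "W2 \<subseteq> A \<union> B" "W3 \<subseteq> A \<union> B"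
    "conn R W1 \<or> conn T W1" "conn R W2 \<or> conn T W2" "conn R W3 \<or> conn T W3"
    "finite U" "A \<union> B \<subseteq> U \<union> W1 \<union> W2 \<union> W3" "card U \<le> 8 * m"
  shows three_cover
proof -
  have "card (A \<union> B - (W1 \<union> W2 \<union> W3)) \<le> card U"
    by (rule card_mono) (use assms in auto)
  then have "card (A \<union> B - (W1 \<union> W2 \<union> W3)) \<le> 8 * m" using assms(12) by linarith
  moreover have "W1 \<union> W2 \<union> W3 \<subseteq> A \<union> B" using assms(4-6) by blast
  moreover have "\<forall>W\<in>{W1, W2, W3}. conn R W \<or> conn T W" using assms(7-9) by blast
  ultimately show ?thesis unfolding three_cover_def using assms(1-3) by blast
qed

section \<open>Sparse vertices, connected cores and splittings\<close>

text \<open>Together, \<open>m\<close> such vertices would see at most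
  \<open>4 * (m * s) \<le> n / 500\<close> vertices of \<open>S\<close>. What remains of
  \<open>S\<close> has at least \<open>n / 34\<close> vertices, so \<open>edgeA\<close> supplies an
  edge to it. The gap between 16 and 34 pays for the removal.\<close>

lemma few_sparse_vertices:
  assumes Y: "Y \<subseteq> A" and S: "S \<subseteq> B" "n \<le> 16 * card S"
    and deg: "\<And>y. y \<in> Y \<Longrightarrow> card {z\<in>S. R y z \<or> T y z} \<le> 4 * s"
  shows "card Y < m"
proof (rule ccontr)
  assume "\<not> card Y < m"
  then obtain Y0 where Y0: "Y0 \<subseteq> Y" "card Y0 = m" "finite Y0"
    using obtain_subset_with_card_n[of m Y] by auto
  define N where "N = (\<Union>y\<in>Y0. {z\<in>S. R y z \<or> T y z})"
  have fS: "finite S" using S finB finite_subset by blast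
  have "card N \<le> (\<Sum>y\<in>Y0. card {z\<in>S. R y z \<or> T y z})"
    unfolding N_def by (rule card_UN_le) (use Y0 in auto)
  also have "\<dots> \<le> (\<Sum>y\<in>Y0. 4 * s)" by (rule sum_mono) (use deg Y0 in auto)
  also have "\<dots> = 4 * (m * s)" using Y0 by simp
  finally have N: "card N \<le> 4 * (m * s)" .
  have "N \<subseteq> S" by (auto simp: N_def)
  then have "card (S - N) = card S - card N" using fS by (simp add: card_Diff_subset finite_subset)
  then have "n \<le> 34 * card (S - N)" using N S(2) sn by linarith
  then have "\<exists>x\<in>Y0. \<exists>y\<in>S - N. R x y \<or> T x y"
    by (intro edgeA) (use Y0 Y S in auto)
  then show False by (auto simp: N_def)
qed

text \<open>A vertex of \<open>S\<close> missed in colour \<open>R\<close> has no edge at all to a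
  fixed \<open>m\<close>-subset of \<open>Y\<close>, which \<open>edgeA\<close> permits for fewer
  than \<open>n / 34\<close> vertices, or an edge of colour \<open>T\<close>, which the degrees
  permit for at most \<open>2 * (m * s) \<le> n / 1000\<close>. The total is below
  \<open>n / 32\<close>, so that two such exceptional sets cannot fill a set of size
  \<open>n / 16\<close>.\<close>

lemma nonneighbours:
  assumes Y: "Y \<subseteq> A" "m \<le> card Y" and S: "S \<subseteq> B"
    and deg: "\<And>y. y \<in> Y \<Longrightarrow> card {z\<in>S. T y z} \<le> 2 * s"
  shows "32 * card {z\<in>S. \<not> (\<exists>y\<in>Y. R y z)} < n"
proof -
  obtain Y0 where Y0: "Y0 \<subseteq> Y" "card Y0 = m" "finite Y0"
    using obtain_subset_with_card_n[of m Y] Y by auto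
  have fS: "finite S" using S finB finite_subset by blast
  define N where "N = (\<Union>y\<in>Y0. {z\<in>S. T y z})"
  define U where "U = {z\<in>S. \<not> (\<exists>y\<in>Y0. R y z \<or> T y z)}"
  have "card N \<le> (\<Sum>y\<in>Y0. card {z\<in>S. T y z})"
    unfolding N_def by (rule card_UN_le) (use Y0 in auto)
  also have "\<dots> \<le> (\<Sum>y\<in>Y0. 2 * s)" by (rule sum_mono) (use deg Y0 in auto)
  also have "\<dots> = 2 * (m * s)" using Y0 by simp
  finally have N: "card N \<le> 2 * (m * s)" .
  have U: "34 * card U < n"
  proof (rule ccontr)
    assume "\<not> 34 * card U < n"
    then have "\<exists>x\<in>Y0. \<exists>y\<in>U. R x y \<or> T x y"
      using edgeA[of Y0 U] Y0 Y S by (auto simp: U_def)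
    then show False by (auto simp: U_def)
  qed
  have "card {z\<in>S. \<not> (\<exists>y\<in>Y. R y z)} \<le> card (U \<union> N)"
    by (rule card_mono) (use Y0 fS in \<open>auto simp: U_def N_def\<close>)
  also have "\<dots> \<le> card U + card N" by (rule card_Un_le)
  finally show ?thesis using U N sn by linarith
qed

text \<open>
  Any two subsets of \<open>X\<close> of size \<open>m\<close> have a common \<open>R\<close>-neighbour in \<open>S\<close>. Hence a smallest subset of size at
  least \<open>m\<close> that is closed under having a common neighbour is connected and misses fewer than \<open>m\<close> vertices.
\<close>

lemma connected_core:
  assumes X: "X \<subseteq> A" "3 * m \<le> card X" and S: "S \<subseteq> B" "n \<le> 16 * card S"
    and deg: "\<And>x. x \<in> X \<Longrightarrow> card {z\<in>S. T x z} \<le> 2 * s"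
  shows "\<exists>D\<subseteq>X. card (X - D) < m \<and> conn R (D \<union> {z\<in>S. \<exists>x\<in>D. R x z})"
proof -
  have fX: "finite X" using X finA finite_subset by blast
  have fS: "finite S" using S finB finite_subset by blast
  define closed where "closed U \<longleftrightarrow> (\<forall>x\<in>U. \<forall>x'\<in>X - U. \<not> (\<exists>z\<in>S. R x z \<and> R x' z))" for U
  have meet: "\<exists>x\<in>U. \<exists>x'\<in>U'. \<exists>z\<in>S. R x z \<and> R x' z"
    if "U \<subseteq> X" "U' \<subseteq> X" "m \<le> card U" "m \<le> card U'" for U U'
  proof (rule ccontr)
    assume neg: "\<not> ?thesis"
    have "card S \<le> card ({z\<in>S. \<not> (\<exists>y\<in>U. R y z)} \<union> {z\<in>S. \<not> (\<exists>y\<in>U'. R y z)})"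
      by (rule card_mono) (use fS neg in auto)
    also have "\<dots> \<le> card {z\<in>S. \<not> (\<exists>y\<in>U. R y z)} + card {z\<in>S. \<not> (\<exists>y\<in>U'. R y z)}"
      by (rule card_Un_le)
    finally have le: "card S \<le> card {z\<in>S. \<not> (\<exists>y\<in>U. R y z)} + card {z\<in>S. \<not> (\<exists>y\<in>U'. R y z)}" .
    have lt: "32 * card {z\<in>S. \<not> (\<exists>y\<in>V. R y z)} < n" if "V \<subseteq> X" "m \<le> card V" for V
      by (rule nonneighbours) (use that X(1) S(1) deg in auto)
    show False using le lt[of U] lt[of U'] that S(2) by linarith
  qed
  define \<U> where "\<U> = {U. U \<subseteq> X \<and> closed U \<and> m \<le> card U}"
  have "X \<in> \<U>" using X m_pos by (auto simp: \<U>_def closed_def)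
  then obtain U where U: "U \<in> \<U>" and min: "\<And>V. V \<in> \<U> \<Longrightarrow> card U \<le> card V"
    using ex_has_least_nat[of "\<lambda>U. U \<in> \<U>" X card] by blast
  have UX: "U \<subseteq> X" "closed U" "m \<le> card U" using U by (auto simp: \<U>_def)
  have fU: "finite U" using UX fX finite_subset by blast
  have big: "card (X - U) < m"
  proof (rule ccontr)
    assume "\<not> ?thesis"
    then show False using meet[of U "X - U"] UX unfolding closed_def by auto
  qed
  \<comment> \<open>If no common neighbour crosses this cut of \<open>U\<close>, both parts are
    closed in \<open>X\<close>, and by minimality each has fewer than \<open>m\<close> vertices. As
    \<open>X - U\<close> is also smaller than \<open>m\<close>, this contradicts
    \<open>3 * m \<le> card X\<close>.\<close>
  have "False" if V: "V \<subseteq> U" "V \<noteq> {}" "V \<noteq> U"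
    and nc: "\<forall>x\<in>V. \<forall>x'\<in>U - V. \<not> (\<exists>z\<in>S. R x z \<and> R x' z)" for V
  proof -
    have "closed V" "closed (U - V)"
      using nc UX V unfolding closed_def by blast+
    moreover have "card V < card U" "card (U - V) < card U"
      by (rule psubset_card_mono[OF fU]; use V in blast)+
    moreover have "V \<subseteq> X" "U - V \<subseteq> X" using V UX by auto
    ultimately have "card V < m" "card (U - V) < m"
      using min[of V] min[of "U - V"] unfolding \<U>_def mem_Collect_eq
      by (metis leD leI)+
    moreover have "card U = card V + card (U - V)"
      using V fU by (metis card_Diff_subset card_mono finite_subset le_add_diff_inverse)
    moreover have "card X = card U + card (X - U)"
      using UX fX by (metis card_Diff_subset card_mono finite_subset le_add_diff_inverse)
    ultimately show False using big X(2) by linarith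
  qed
  note cut = this
  have "conn R (U \<union> {z\<in>S. \<exists>x\<in>U. R x z})" (is "conn R (U \<union> ?N)")
    unfolding conn_def
  proof (intro allI impI)
    fix V assume V: "V \<subseteq> U \<union> ?N" "V \<noteq> {}" "V \<noteq> U \<union> ?N"
    show "\<exists>x\<in>V. \<exists>y\<in>U \<union> ?N - V. R x y"
    proof (rule ccontr)
      assume neg: "\<not> ?thesis"
      have AB: "x \<notin> U" if "x \<in> S" for x using that UX X S disj by blast
      have "V \<inter> U = {} \<or> V \<inter> U = U"
      proof (rule ccontr)
        assume "\<not> ?thesis"
        then obtain x x' z where "x \<in> V \<inter> U" "x' \<in> U - V \<inter> U" "z \<in> S" "R x z" "R x' z"
          using cut[of "V \<inter> U"] by blast
        then show False using neg symR by blast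
      qed
      then show False
      proof
        assume "V \<inter> U = {}"
        then obtain v where "v \<in> V" "v \<in> ?N" using V by blast
        then show False using neg symR \<open>V \<inter> U = {}\<close> by blast
      next
        assume "V \<inter> U = U"
        then obtain v where "v \<notin> V" "v \<in> ?N" using V by blast
        then show False using neg symR \<open>V \<inter> U = U\<close> by blast
      qed
    qed
  qed
  then show ?thesis using UX big by blast
qed

text \<open>A set \<open>X\<close> too small for \<open>connected_core\<close> is given up entirely,
  with \<open>D = {}\<close>. The price is a loss of \<open>3 * m\<close> vertices instead of
  \<open>m\<close>; in return, no later case has to ask how many vertices are left to
  connect.\<close>

lemma connected_core_weak:
  assumes X: "X \<subseteq> A" and S: "S \<subseteq> B" "n \<le> 16 * card S"
    and deg: "\<And>x. x \<in> X \<Longrightarrow> card {z\<in>S. T x z} \<le> 2 * s"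
  shows "\<exists>D\<subseteq>X. card (X - D) \<le> 3 * m \<and> conn R (D \<union> {z\<in>S. \<exists>x\<in>D. R x z})"
proof (cases "3 * m \<le> card X")
  case True
  then obtain D where "D \<subseteq> X" "card (X - D) < m" "conn R (D \<union> {z\<in>S. \<exists>x\<in>D. R x z})"
    using connected_core[of X S] assms by blast
  then show ?thesis by (intro exI[of _ D]) auto
next
  case False
  then show ?thesis by (intro exI[of _ "{}"]) auto
qed

text \<open>\<open>property_B\<close> is applied to all neighbourhoods in \<open>U\<close> of size
  at least \<open>L\<close>, in both colours. They number at most \<open>4 * n\<close>, which
  explains \<open>8 * n < 2 ^ L\<close>. The requirement is symmetric in \<open>P\<close> and
  \<open>U - P\<close>, so the larger half may be called \<open>U - P\<close>.\<close>

lemma splitting: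
  assumes U: "U \<subseteq> A \<union> B"
  shows "\<exists>P\<subseteq>U. card U \<le> 2 * card (U - P) \<and> (\<forall>v\<in>A \<union> B.
     (L \<le> card {u\<in>U. R v u} \<longrightarrow> (\<exists>u\<in>P. R v u) \<and> (\<exists>u\<in>U - P. R v u)) \<and>
     (L \<le> card {u\<in>U. T v u} \<longrightarrow> (\<exists>u\<in>P. T v u) \<and> (\<exists>u\<in>U - P. T v u)))"
proof -
  have fU: "finite U" using U finA finB finite_subset by blast
  define \<F> where "\<F> = {F \<in> (\<lambda>v. {u\<in>U. R v u}) ` (A \<union> B) \<union> (\<lambda>v. {u\<in>U. T v u}) ` (A \<union> B). L \<le> card F}"
  have fin: "finite \<F>" using finA finB by (simp add: \<F>_def)
  have "card \<F> \<le> card ((\<lambda>v. {u\<in>U. R v u}) ` (A \<union> B) \<union> (\<lambda>v. {u\<in>U. T v u}) ` (A \<union> B))"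
    by (rule card_mono) (use finA finB in \<open>auto simp: \<F>_def\<close>)
  also have "\<dots> \<le> card ((\<lambda>v. {u\<in>U. R v u}) ` (A \<union> B)) + card ((\<lambda>v. {u\<in>U. T v u}) ` (A \<union> B))"
    by (rule card_Un_le)
  also have "\<dots> \<le> card (A \<union> B) + card (A \<union> B)"
    by (intro add_mono card_image_le) (use finA finB in auto)
  also have "\<dots> \<le> 4 * n" using card_Un_le[of A B] cardA cardB by simp
  finally have "2 * card \<F> < 2 ^ L" using nL by linarith
  then obtain P where P: "P \<subseteq> U" "\<forall>F\<in>\<F>. F \<inter> P \<noteq> {} \<and> F - P \<noteq> {}"
    using property_B[of U \<F> L] fU fin unfolding \<F>_def by blast
  have main: "\<forall>v\<in>A \<union> B.
     (L \<le> card {u\<in>U. R v u} \<longrightarrow> (\<exists>u\<in>P. R v u) \<and> (\<exists>u\<in>U - P. R v u)) \<and>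
     (L \<le> card {u\<in>U. T v u} \<longrightarrow> (\<exists>u\<in>P. T v u) \<and> (\<exists>u\<in>U - P. T v u))"
  proof (intro ballI conjI impI)
    fix v assume v: "v \<in> A \<union> B"
    { assume "L \<le> card {u\<in>U. R v u}"
      then have "{u\<in>U. R v u} \<in> \<F>" using v by (auto simp: \<F>_def)
      from bspec[OF P(2) this] show "\<exists>u\<in>P. R v u" "\<exists>u\<in>U - P. R v u" by auto }
    { assume "L \<le> card {u\<in>U. T v u}"
      then have "{u\<in>U. T v u} \<in> \<F>" using v by (auto simp: \<F>_def)
      from bspec[OF P(2) this] show "\<exists>u\<in>P. T v u" "\<exists>u\<in>U - P. T v u" by auto }
  qed
  have c: "card (U - P) + card P = card U"
    using P fU by (metis add.commute card_Diff_subset card_mono finite_subset le_add_diff_inverse)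
  show ?thesis
  proof (cases "card U \<le> 2 * card (U - P)")
    case True then show ?thesis using main P(1) by blast
  next
    case False
    have "U - (U - P) = P" using P(1) by blast
    then show ?thesis using main c False by (intro exI[of _ "U - P"]) auto
  qed
qed

text \<open>
  A vertex with at least \<open>L\<close> neighbours of colour \<open>R\<close> in \<open>A1\<close> or \<open>B1\<close> joins the core through one half of a
  splitting. The remaining vertices are almost monochromatic in \<open>T\<close> towards \<open>A1\<close> and \<open>B1\<close>, so on each side they
  are connected in \<open>T\<close> through the other half, whose vertices the core can spare.
\<close>

lemma three_cover_if_core:
  assumes K: "K \<subseteq> A \<union> B" "conn R K" and A1: "A1 \<subseteq> A - K" "n \<le> 8 * card A1" "\<And>x. x \<in> A1 \<Longrightarrow> \<exists>k\<in>K. R k x"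
    and B1: "B1 \<subseteq> B - K" "n \<le> 8 * card B1" "\<And>x. x \<in> B1 \<Longrightarrow> \<exists>k\<in>K. R k x"
  shows three_cover
proof -
  interpret sw: two_coloured B A R T n m s L by (rule swap_sides)
  interpret co: two_coloured A B T R n m s L by (rule swap_colours)
  interpret swco: two_coloured B A T R n m s L by (rule sw.swap_colours)
  obtain P where P: "P \<subseteq> A1" "card A1 \<le> 2 * card (A1 - P)"
    and Phit: "\<And>v. v \<in> A \<union> B \<Longrightarrow> L \<le> card {u\<in>A1. R v u} \<Longrightarrow> \<exists>u\<in>P. R v u"
    using splitting[of A1] A1(1) by blast
  obtain P' where P': "P' \<subseteq> B1" "card B1 \<le> 2 * card (B1 - P')"
    and P'hit: "\<And>v. v \<in> A \<union> B \<Longrightarrow> L \<le> card {u\<in>B1. R v u} \<Longrightarrow> \<exists>u\<in>P'. R v u"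
    using splitting[of B1] B1(1) by blast
  define A2 where "A2 = {x\<in>A - K - A1. \<not> L \<le> card {z\<in>B1. R x z}}"
  define B2 where "B2 = {x\<in>B - K - B1. \<not> L \<le> card {z\<in>A1. R x z}}"
  have fin1: "finite A1" "finite B1" using A1 B1 finA finB by (meson finite_Diff finite_subset)+
  have "card {z\<in>B1 - P'. R x z} \<le> 2 * s" if "x \<in> A2" for x
  proof -
    have "card {z\<in>B1 - P'. R x z} \<le> card {z\<in>B1. R x z}"
      by (rule card_mono) (use fin1 in auto)
    then show ?thesis using that Ls by (auto simp: A2_def)
  qed
  then obtain D where D: "D \<subseteq> A2" "card (A2 - D) \<le> 3 * m"
    "conn T (D \<union> {z\<in>B1 - P'. \<exists>x\<in>D. T x z})"
    using co.connected_core_weak[of A2 "B1 - P'"] B1 P' by (auto simp: A2_def)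
  have "card {z\<in>A1 - P. R x z} \<le> 2 * s" if "x \<in> B2" for x
  proof -
    have "card {z\<in>A1 - P. R x z} \<le> card {z\<in>A1. R x z}"
      by (rule card_mono) (use fin1 in auto)
    then show ?thesis using that Ls by (auto simp: B2_def)
  qed
  then obtain D' where D': "D' \<subseteq> B2" "card (B2 - D') \<le> 3 * m"
    "conn T (D' \<union> {z\<in>A1 - P. \<exists>x\<in>D'. T x z})"
    using swco.connected_core_weak[of B2 "A1 - P"] A1 P by (auto simp: B2_def)
  define Z where "Z = {z\<in>B1 - P'. \<exists>x\<in>D. T x z}"
  define Z' where "Z' = {z\<in>A1 - P. \<exists>x\<in>D'. T x z}"
  \<comment> \<open>All vertices of \<open>A1\<close> and \<open>B1\<close> hang directly on
    \<open>K\<close>, so giving \<open>Z\<close> and \<open>Z'\<close> away disconnects nothing. As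
    \<open>P\<close> and \<open>P'\<close> avoid these sets, they remain available for attaching
    further vertices.\<close>
  have c0: "conn R (K \<union> ((A1 - Z') \<union> (B1 - Z)))" (is "conn R ?K")
    by (rule conn_attach[OF symR K(2)]) (use A1 B1 in blast)+
  have c1: "conn R (?K \<union> ((A - K - A1 - A2) \<union> (B - K - B1 - B2)))"
  proof (rule conn_attach[OF symR c0])
    fix y assume "y \<in> (A - K - A1 - A2) \<union> (B - K - B1 - B2)"
    then consider "y \<in> A \<union> B" "L \<le> card {z\<in>B1. R y z}" | "y \<in> A \<union> B" "L \<le> card {z\<in>A1. R y z}"
      by (auto simp: A2_def B2_def)
    then show "\<exists>w\<in>?K. R w y"
    proof cases
      case 1
      then obtain u where "u \<in> P'" "R y u" using P'hit by blast
      then show ?thesis using P' symR by (auto simp: Z_def)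
    next
      case 2
      then obtain u where "u \<in> P" "R y u" using Phit by blast
      then show ?thesis using P symR by (auto simp: Z'_def)
    qed
  qed
  have sub: "A2 \<subseteq> A - K - A1" "B2 \<subseteq> B - K - B1" "Z \<subseteq> B1" "Z' \<subseteq> A1"
    by (auto simp: A2_def B2_def Z_def Z'_def)
  show ?thesis
  proof (rule three_coverI[OF _ _ _ _ _ _ disjI1[OF c1] disjI2[OF D(3)] disjI2[OF D'(3)]],
      unfold Z_def[symmetric] Z'_def[symmetric])
    show "finite ((A2 - D) \<union> (B2 - D'))"
      using sub finA finB by (meson finite_Diff finite_Un finite_subset)
    show "card ((A2 - D) \<union> (B2 - D')) \<le> 8 * m"
      using card_Un_le[of "A2 - D" "B2 - D'"] D(2) D'(2) by linarith
  qed (use sub D(1) D'(1) K(1) A1(1) B1(1) disj in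
      \<open>(unfold subset_iff disjoint_iff Un_iff Diff_iff; blast)\<close>)+
qed

section \<open>Three trees for each distribution of the sparse vertices\<close>

text \<open>\<open>Dr\<close> is an \<open>R\<close>-core on one side and \<open>Db\<close> a
  \<open>T\<close>-core on the other; \<open>Bc\<close> and \<open>Ac\<close> are the blocks that
  keep them connected, \<open>B1\<close> and \<open>A1\<close> their neighbourhoods. The vertices
  counted in \<open>A1f\<close> fit both trees, in \<open>T\<close> through \<open>Db\<close> and in
  \<open>R\<close> through \<open>B1\<close>. Splitting them serves the remaining vertices of
  \<open>B\<close> in either colour, except for fewer than \<open>m\<close>. A remaining vertex of
  \<open>A\<close> either joins the \<open>R\<close>-tree through half of \<open>B1 - Bc\<close>, or
  has few \<open>R\<close>-neighbours there; the latter form the third tree, in \<open>T\<close>, on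
  the other half.\<close>

lemma three_cover_opposite_sides_aux:
  assumes Dr: "Dr \<subseteq> A" and Db: "Db \<subseteq> B" and Ac: "Ac \<subseteq> A - Dr" and Bc: "Bc \<subseteq> B - Db"
    and cr: "conn R (Dr \<union> {z\<in>Bc. \<exists>x\<in>Dr. R x z})"
    and cb: "conn T (Db \<union> {z\<in>Ac. \<exists>x\<in>Db. T x z})"
    and A1: "A1 = {x\<in>A - Dr. \<exists>z\<in>Db. T z x}" and B1: "B1 = {z\<in>B - Db. \<exists>x\<in>Dr. R x z}"
    and A1f: "n \<le> 16 * card {x\<in>A1 - Ac. L \<le> card {z\<in>B1 - Bc. R x z}}"
    and B1big: "n \<le> 8 * card (B1 - Bc)"
  shows three_cover
proof -
  interpret sw: two_coloured B A R T n m s L by (rule swap_sides)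
  interpret co: two_coloured A B T R n m s L by (rule swap_colours)
  define Af where "Af = {x\<in>A1 - Ac. L \<le> card {z\<in>B1 - Bc. R x z}}"
  have subs: "A1 \<subseteq> A - Dr" "B1 \<subseteq> B - Db" "Af \<subseteq> A1 - Ac" using A1 B1 by (auto simp: Af_def)
  have fin: "finite A1" "finite B1" "finite Af"
    using subs finA finB by (meson finite_Diff finite_subset)+
  have "B1 - Bc \<subseteq> A \<union> B" "Af \<subseteq> A \<union> B" using subs by blast+
  from splitting[OF this(1)] obtain P where P: "P \<subseteq> B1 - Bc" "card (B1 - Bc) \<le> 2 * card (B1 - Bc - P)"
    and Phit: "\<And>v. v \<in> A \<union> B \<Longrightarrow> L \<le> card {u\<in>B1 - Bc. R v u} \<Longrightarrow> \<exists>u\<in>P. R v u"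
    by blast
  from splitting[OF \<open>Af \<subseteq> A \<union> B\<close>] obtain Q where Q: "Q \<subseteq> Af"
    and QR: "\<And>v. v \<in> A \<union> B \<Longrightarrow> L \<le> card {u\<in>Af. R v u} \<Longrightarrow> \<exists>u\<in>Q. R v u"
    and QT: "\<And>v. v \<in> A \<union> B \<Longrightarrow> L \<le> card {u\<in>Af. T v u} \<Longrightarrow> \<exists>u\<in>Af - Q. T v u"
    by blast
  define U0 where "U0 = {v\<in>B - Db - B1. \<not> L \<le> card {x\<in>Af. R v x} \<and> \<not> L \<le> card {x\<in>Af. T v x}}"
  have "card U0 < m"
  proof (rule sw.few_sparse_vertices[of _ Af])
    fix y assume "y \<in> U0"
    then have "card {x\<in>Af. R y x} + card {x\<in>Af. T y x} \<le> 4 * s" using Ls by (auto simp: U0_def)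
    moreover have "{x\<in>Af. R y x \<or> T y x} = {x\<in>Af. R y x} \<union> {x\<in>Af. T y x}" by auto
    ultimately show "card {z\<in>Af. R y z \<or> T y z} \<le> 4 * s"
      using card_Un_le[of "{x\<in>Af. R y x}" "{x\<in>Af. T y x}"] by simp
  qed (use A1f subs in \<open>auto simp: U0_def Af_def\<close>)
  define Vr where "Vr = {v\<in>B - Db - B1 - U0. \<exists>x\<in>Q. R x v}"
  define Vb where "Vb = B - Db - B1 - U0 - Vr"
  define A2 where "A2 = {x\<in>A - Dr - A1. \<not> L \<le> card {z\<in>B1 - Bc. R x z}}"
  define V where "V = A - Dr - A1 - A2"
  have Vb: "\<exists>x\<in>Af - Q. T x v" if "v \<in> Vb" for v
  proof -
    have v: "v \<in> A \<union> B" "v \<notin> U0" "\<not> (\<exists>x\<in>Q. R x v)" "v \<in> B - Db - B1" using that by (auto simp: Vb_def Vr_def)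
    then have "\<not> L \<le> card {u\<in>Af. R v u}" using QR symR by blast
    then have "L \<le> card {u\<in>Af. T v u}" using v by (auto simp: U0_def)
    then show ?thesis using QT v symT by blast
  qed
  have "card {z\<in>B1 - Bc - P. R x z} \<le> 2 * s" if "x \<in> A2" for x
  proof -
    have "card {z\<in>B1 - Bc - P. R x z} \<le> card {z\<in>B1 - Bc. R x z}"
      by (rule card_mono) (use fin in auto)
    then show ?thesis using that Ls by (auto simp: A2_def)
  qed
  moreover have "n \<le> 16 * card (B1 - Bc - P)" using P(2) B1big by linarith
  moreover have "A2 \<subseteq> A" "B1 - Bc - P \<subseteq> B" using subs by (auto simp: A2_def)
  ultimately obtain D where D: "D \<subseteq> A2" "card (A2 - D) \<le> 3 * m"
    "conn T (D \<union> {z\<in>B1 - Bc - P. \<exists>x\<in>D. T x z})"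
    using co.connected_core_weak[of A2 "B1 - Bc - P"] by blast
  define Z where "Z = {z\<in>B1 - Bc - P. \<exists>x\<in>D. T x z}"
  have ZP: "Z \<subseteq> B1 - Bc - P" by (auto simp: Z_def)
  have ex: "\<exists>u\<in>P. R u y" if "y \<in> Q \<union> V" for y
  proof -
    have "y \<in> A \<union> B" "L \<le> card {u\<in>B1 - Bc. R y u}"
      using that Q subs by (auto simp: V_def A2_def Af_def)
    then show ?thesis using Phit symR by blast
  qed
  \<comment> \<open>\<open>Z\<close> avoids \<open>Bc\<close> and \<open>P\<close>. Removing it
    costs only leaves that hang on \<open>Dr\<close>: the core stays connected, and \<open>P\<close>
    can still attach \<open>Q\<close> and \<open>V\<close>.\<close>
  have r1: "conn R (Dr \<union> (B1 - Z))"
    by (rule conn_attach_subset[OF symR cr]) (use B1 Bc ZP in blast)+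
  have r2: "conn R (Dr \<union> (B1 - Z) \<union> (Q \<union> V))"
    by (rule conn_attach[OF symR r1]) (use ex P ZP in blast)+
  have r3: "conn R (Dr \<union> (B1 - Z) \<union> (Q \<union> V) \<union> Vr)"
    by (rule conn_attach[OF symR r2]) (auto simp: Vr_def)
  have b1: "conn T (Db \<union> (A1 - Q))"
    by (rule conn_attach_subset[OF symT cb]) (use A1 Ac Q subs in blast)+
  have b2: "conn T (Db \<union> (A1 - Q) \<union> Vb)"
    by (rule conn_attach[OF symT b1]) (use Vb subs in blast)+
  have subs2: "U0 \<subseteq> B - Db - B1" "Vr \<subseteq> B - Db - B1 - U0" "A2 \<subseteq> A - Dr - A1"
    by (auto simp: U0_def Vr_def A2_def)
  show ?thesis
  proof (rule three_coverI[OF _ _ _ _ _ _ disjI1[OF r3] disjI2[OF b2] disjI2[OF D(3)]],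
      unfold Z_def[symmetric])
    show "finite (U0 \<union> (A2 - D))"
      using subs2 finA finB by (meson finite_Diff finite_Un finite_subset)
    show "card (U0 \<union> (A2 - D)) \<le> 8 * m"
      using card_Un_le[of U0 "A2 - D"] D(2) \<open>card U0 < m\<close> by linarith
  qed (use subs subs2 Dr Db D(1) Q ZP disj in
      \<open>(unfold V_def Vb_def subset_iff disjoint_iff Un_iff Diff_iff; blast)\<close>)+
qed

lemma three_cover_swap_sides: "two_coloured.three_cover B A R T m \<Longrightarrow> three_cover"
  unfolding three_cover_def two_coloured.three_cover_def[OF swap_sides] by (simp only: Un_commute[of B A])

lemma three_cover_swap_colours: "two_coloured.three_cover A B T R m \<Longrightarrow> three_cover"
  unfolding three_cover_def two_coloured.three_cover_def[OF swap_colours] by (subst disj_commute)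

lemma obtain_block_size: obtains k where "n \<le> 16 * k" "16 * k \<le> n + 16"
  by (rule that[of "n div 16 + 1"]) auto

text \<open>Vertices sparse in \<open>T\<close> on one side form an \<open>R\<close>-core, those
  sparse in \<open>R\<close> on the other side a \<open>T\<close>-core. A linear number of vertices
  that fit both trees then exists on at least one side, \<open>Af\<close> or \<open>Bf\<close>;
  interchanging sides and colours reduces one alternative to the other.\<close>

lemma three_cover_opposite_sides:
  assumes a: "3 * m \<le> card {x\<in>A. card {y\<in>B. T x y} < 2 * s}"
    and b: "3 * m \<le> card {y\<in>B. card {x\<in>A. R y x} < 2 * s}"
  shows three_cover
proof -
  interpret sw: two_coloured B A R T n m s L by (rule swap_sides)
  interpret co: two_coloured A B T R n m s L by (rule swap_colours)
  interpret swco: two_coloured B A T R n m s L by (rule sw.swap_colours)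
  obtain k where block: "n \<le> 16 * k" "16 * k \<le> n + 16" by (rule obtain_block_size)
  note num = numeric block m_pos ms
  \<comment> \<open>Exactly \<open>3 * m\<close> vertices: enough for \<open>connected_core\<close>,
    and few enough that almost all of the side stays available.\<close>
  obtain Xr where Xr: "Xr \<subseteq> {x\<in>A. card {y\<in>B. T x y} < 2 * s}" "card Xr = 3 * m"
    by (rule obtain_subset_with_card_n[OF a])
  obtain Xb where Xb: "Xb \<subseteq> {y\<in>B. card {x\<in>A. R y x} < 2 * s}" "card Xb = 3 * m"
    by (rule obtain_subset_with_card_n[OF b])
  have XA: "Xr \<subseteq> A" "finite Xr" and XB: "Xb \<subseteq> B" "finite Xb" using Xr Xb finA finB
    by (auto intro: finite_subset)
  have "card (A - Xr) = n - 3 * m" "card (B - Xb) = n - 3 * m"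
    using Xr(2) Xb(2) cardA cardB by (simp_all add: card_Diff_subset XA XB)
  then have "k \<le> card (A - Xr)" "k \<le> card (B - Xb)" using num by linarith+
  then obtain Ac Bc where Ac: "Ac \<subseteq> A - Xr" "card Ac = k" and Bc: "Bc \<subseteq> B - Xb" "card Bc = k"
    by (metis obtain_subset_with_card_n)
  have cAB: "Ac \<subseteq> A" "Bc \<subseteq> B" using Ac Bc by auto
  have fc: "finite Ac" "finite Bc" using Ac Bc finA finB by (meson finite_Diff finite_subset)+
  have degr: "card {z\<in>S. T x z} \<le> 2 * s" if "x \<in> Xr" "S \<subseteq> B" for x S
  proof -
    have "card {z\<in>S. T x z} \<le> card {z\<in>B. T x z}" by (rule card_mono) (use finB that in auto)
    then show ?thesis using that Xr by fastforce
  qed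
  have degb: "card {z\<in>S. R x z} \<le> 2 * s" if "x \<in> Xb" "S \<subseteq> A" for x S
  proof -
    have "card {z\<in>S. R x z} \<le> card {z\<in>A. R x z}" by (rule card_mono) (use finA that in auto)
    then show ?thesis using that Xb by fastforce
  qed
  have "\<exists>D\<subseteq>Xr. card (Xr - D) < m \<and> conn R (D \<union> {z\<in>Bc. \<exists>x\<in>D. R x z})"
    by (rule connected_core) (use XA Xr(2) Bc(2) cAB block degr in simp_all)
  then obtain Dr where Dr: "Dr \<subseteq> Xr" "card (Xr - Dr) < m" "conn R (Dr \<union> {z\<in>Bc. \<exists>x\<in>Dr. R x z})"
    by blast
  have "\<exists>D\<subseteq>Xb. card (Xb - D) < m \<and> conn T (D \<union> {z\<in>Ac. \<exists>x\<in>D. T x z})"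
    by (rule swco.connected_core) (use XB Xb(2) Ac(2) cAB block degb in simp_all)
  then obtain Db where Db: "Db \<subseteq> Xb" "card (Xb - Db) < m" "conn T (Db \<union> {z\<in>Ac. \<exists>x\<in>Db. T x z})"
    by blast
  have cD: "m \<le> card Dr" "m \<le> card Db" "card Dr \<le> 3 * m" "card Db \<le> 3 * m"
    using Dr(1,2) Db(1,2) Xr(2) Xb(2) card_mono[OF XA(2) Dr(1)] card_mono[OF XB(2) Db(1)]
      card_Diff_subset[OF finite_subset[OF Dr(1) XA(2)] Dr(1)] card_Diff_subset[OF finite_subset[OF Db(1) XB(2)] Db(1)]
    by linarith+
  define A1 where "A1 = {x\<in>A - Dr. \<exists>z\<in>Db. T z x}"
  define B1 where "B1 = {z\<in>B - Db. \<exists>x\<in>Dr. R x z}"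
  have nB: "32 * card {z\<in>B. \<not> (\<exists>x\<in>Dr. R x z)} < n"
    by (rule nonneighbours) (use Dr(1) XA cD in \<open>auto intro: degr\<close>)
  have nA: "32 * card {z\<in>A. \<not> (\<exists>x\<in>Db. T x z)} < n"
    by (rule swco.nonneighbours) (use Db(1) XB cD in \<open>auto intro: degb\<close>)
  have fin: "finite Dr" "finite Db" "finite A1" "finite B1"
    using Dr Db XA XB finA finB by (auto simp: A1_def B1_def intro: finite_subset)
  have "card A \<le> card ({z\<in>A. \<not> (\<exists>x\<in>Db. T x z)} \<union> Dr \<union> Ac \<union> (A1 - Ac))"
    by (rule card_mono) (use finA fin fc in \<open>auto simp: A1_def\<close>)
  also have "\<dots> \<le> card {z\<in>A. \<not> (\<exists>x\<in>Db. T x z)} + card Dr + card Ac + card (A1 - Ac)"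
    by (meson add_mono card_Un_le le_refl order_trans)
  finally have cA1: "23 * n \<le> 32 * card (A1 - Ac)"
    using nA cardA cD Ac num by linarith
  have "card B \<le> card ({z\<in>B. \<not> (\<exists>x\<in>Dr. R x z)} \<union> Db \<union> Bc \<union> (B1 - Bc))"
    by (rule card_mono) (use finB fin fc in \<open>auto simp: B1_def\<close>)
  also have "\<dots> \<le> card {z\<in>B. \<not> (\<exists>x\<in>Dr. R x z)} + card Db + card Bc + card (B1 - Bc)"
    by (meson add_mono card_Un_le le_refl order_trans)
  finally have cB1: "23 * n \<le> 32 * card (B1 - Bc)"
    using nB cardB cD Bc num by linarith
  define Af where "Af = {x\<in>A1 - Ac. L \<le> card {z\<in>B1 - Bc. R x z}}"
  define Bf where "Bf = {x\<in>B1 - Bc. L \<le> card {z\<in>A1 - Ac. T x z}}"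
  have AB1: "A1 \<subseteq> A" "B1 \<subseteq> B" by (auto simp: A1_def B1_def)
  have "n \<le> 16 * card Af \<or> n \<le> 16 * card Bf"
  proof (rule ccontr)
    assume neg: "\<not> ?thesis"
    define An where "An = A1 - Ac - Af"
    define Bn where "Bn = B1 - Bc - Bf"
    have finn: "finite An" "finite Bn" using fin by (auto simp: An_def Bn_def)
    have "card Bn = card (B1 - Bc) - card Bf"
      unfolding Bn_def by (rule card_Diff_subset) (use fin in \<open>auto simp: Bf_def\<close>)
    then have cBn: "21 * n \<le> 32 * card Bn" using neg cB1 by linarith
    have "card An = card (A1 - Ac) - card Af"
      unfolding An_def by (rule card_Diff_subset) (use fin in \<open>auto simp: Af_def\<close>)
    then have cAn: "21 * n \<le> 32 * card An" using neg cA1 by linarith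
    have cAn': "card An \<le> n" using AB1 finA cardA card_mono[of A An] by (auto simp: An_def)
    have dA: "card {z\<in>Bn. R x z} < L" if "x \<in> An" for x
    proof -
      have "card {z\<in>Bn. R x z} \<le> card {z\<in>B1 - Bc. R x z}"
        by (rule card_mono) (use fin in \<open>auto simp: Bn_def\<close>)
      then show ?thesis using that by (auto simp: An_def Af_def)
    qed
    have dB: "card {z\<in>An. T x z} < L" if "x \<in> Bn" for x
    proof -
      have "card {z\<in>An. T x z} \<le> card {z\<in>A1 - Ac. T x z}"
        by (rule card_mono) (use fin in \<open>auto simp: An_def\<close>)
      then show ?thesis using that by (auto simp: Bn_def Bf_def)
    qed
    \<comment> \<open>Vertices of \<open>An\<close> have fewer than \<open>L\<close> neighbours of
      colour \<open>R\<close> in \<open>Bn\<close>. By double counting, at most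
      \<open>card An / 3\<close> vertices of \<open>Bn\<close> have \<open>3 * L\<close> or more
      such neighbours in \<open>An\<close>. All others have fewer than \<open>4 * L\<close> edges
      into \<open>An\<close>, which is too many sparse vertices.\<close>
    define Y where "Y = {v\<in>Bn. 3 * L \<le> card {x\<in>An. R x v}}"
    have "card Y * (3 * L) = (\<Sum>v\<in>Y. 3 * L)" by simp
    also have "\<dots> \<le> (\<Sum>v\<in>Y. card {x\<in>An. R x v})" by (rule sum_mono) (auto simp: Y_def)
    also have "\<dots> \<le> (\<Sum>v\<in>Bn. card {x\<in>An. R x v})"
      by (rule sum_mono2) (use finn in \<open>auto simp: Y_def\<close>)
    also have "\<dots> = (\<Sum>x\<in>An. card {v\<in>Bn. R x v})"
      by (rule sum_multicount_gen) (use finn in auto)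
    also have "\<dots> \<le> (\<Sum>x\<in>An. L)" by (rule sum_mono) (use dA in force)
    also have "\<dots> = card An * L" by simp
    finally have "3 * card Y \<le> card An" using numeric(5) by (simp add: mult.assoc mult.commute[of L])
    moreover have "card (Bn - Y) = card Bn - card Y"
      by (rule card_Diff_subset) (use finn in \<open>auto simp: Y_def\<close>)
    ultimately have c: "m \<le> card (Bn - Y)" using cAn' cBn num by linarith
    have "card (Bn - Y) < m"
    proof (rule sw.few_sparse_vertices[of _ An])
      fix y assume y: "y \<in> Bn - Y"
      have "{z\<in>An. R y z \<or> T y z} = {z\<in>An. R z y} \<union> {z\<in>An. T y z}" using symR by auto
      then have "card {z\<in>An. R y z \<or> T y z} \<le> card {z\<in>An. R z y} + card {z\<in>An. T y z}"
        by (simp add: card_Un_le)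
      then show "card {z\<in>An. R y z \<or> T y z} \<le> 4 * s" using y dB[of y] Ls by (auto simp: Y_def)
    qed (use AB1 cAn in \<open>auto simp: An_def Bn_def\<close>)
    then show False using c by simp
  qed
  then show ?thesis
  proof
    assume f: "n \<le> 16 * card Af"
    show ?thesis
      by (rule three_cover_opposite_sides_aux[OF _ _ _ _ Dr(3) Db(3) A1_def B1_def f[unfolded Af_def]])
         (use Dr(1) Db(1) Ac(1) Bc(1) XA XB cB1 in \<open>auto simp: A1_def B1_def\<close>)
  next
    assume f: "n \<le> 16 * card Bf"
    have "swco.three_cover"
      by (rule swco.three_cover_opposite_sides_aux[OF _ _ _ _ Db(3) Dr(3) B1_def A1_def f[unfolded Bf_def]])
         (use Dr(1) Db(1) Ac(1) Bc(1) XA XB cA1 in \<open>auto simp: A1_def B1_def\<close>)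
    then show ?thesis by (intro three_cover_swap_sides sw.three_cover_swap_colours)
  qed
qed

text \<open>
  Two cores \<open>Dr\<close> and \<open>Db\<close> of different colours on the same side reach most of \<open>B\<close> in both colours, so the
  vertices of \<open>A\<close> can be attached, and those with many neighbours of both colours to either tree. The
  vertices \<open>B3\<close> that attach to neither tree see only the tree of the wrong colour, and are
  connected through vertices of that tree that are its leaves.
\<close>

lemma three_cover_same_side:
  assumes a: "4 * m \<le> card {x\<in>A. card {y\<in>B. T x y} < 2 * s}"
    and b: "4 * m \<le> card {x\<in>A. card {y\<in>B. R x y} < 2 * s}"
  shows three_cover
proof -
  interpret sw: two_coloured B A R T n m s L by (rule swap_sides)
  interpret co: two_coloured A B T R n m s L by (rule swap_colours)
  interpret swco: two_coloured B A T R n m s L by (rule sw.swap_colours)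
  obtain k where block: "n \<le> 16 * k" "16 * k \<le> n + 16" by (rule obtain_block_size)
  note num = numeric block m_pos ms
  define AR where "AR = {x\<in>A. card {y\<in>B. T x y} < 2 * s}"
  define AT where "AT = {x\<in>A. card {y\<in>B. R x y} < 2 * s}"
  have ATA: "AR \<subseteq> A" "AT \<subseteq> A" by (auto simp: AR_def AT_def)
  have fAT: "finite AR" "finite AT" using ATA finA finite_subset by auto
  \<comment> \<open>A vertex sparse in both colours has fewer than \<open>4 * s\<close> edges in
    all. Discarding these vertices makes the two cores disjoint and costs less than
    \<open>m\<close>, hence the threshold \<open>4 * m\<close> where a core needs
    \<open>3 * m\<close>.\<close>
  have low: "card (AR \<inter> AT) < m"
  proof (rule few_sparse_vertices[of _ B])
    fix x assume x: "x \<in> AR \<inter> AT"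
    have "{y\<in>B. R x y \<or> T x y} = {y\<in>B. R x y} \<union> {y\<in>B. T x y}" by auto
    then have "card {y\<in>B. R x y \<or> T x y} \<le> card {y\<in>B. R x y} + card {y\<in>B. T x y}"
      by (simp add: card_Un_le)
    then show "card {y\<in>B. R x y \<or> T x y} \<le> 4 * s" using x by (auto simp: AR_def AT_def)
  qed (use ATA cardB in auto)
  have "AT - AR = AT - AR \<inter> AT" by blast
  then have "card (AT - AR) = card AT - card (AR \<inter> AT)"
    using card_Diff_subset[of "AR \<inter> AT" AT] fAT by auto
  then have b': "3 * m \<le> card (AT - AR)" using b low unfolding AT_def by linarith
  have a': "3 * m \<le> card AR" using a unfolding AR_def by linarith
  obtain Xr where Xr: "Xr \<subseteq> AR" "card Xr = 3 * m" by (rule obtain_subset_with_card_n[OF a'])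
  obtain Xb where Xb: "Xb \<subseteq> AT - AR" "card Xb = 3 * m" by (rule obtain_subset_with_card_n[OF b'])
  have XA: "Xr \<subseteq> A" "finite Xr" "Xb \<subseteq> A" "finite Xb" using Xr Xb ATA fAT
    by (auto intro: finite_subset)
  have "k \<le> card B" using cardB num by linarith
  then obtain B1 where B1: "B1 \<subseteq> B" "card B1 = k" by (meson obtain_subset_with_card_n)
  have fB1: "finite B1" using B1 finB finite_subset by auto
  have "k \<le> card (B - B1)" using cardB num B1 fB1 by (simp add: card_Diff_subset)
  then obtain B2 where B2: "B2 \<subseteq> B - B1" "card B2 = k" by (meson obtain_subset_with_card_n)
  have fB2: "finite B2" using B2 finB by (meson finite_Diff finite_subset)
  have B2B: "B2 \<subseteq> B" using B2 by auto
  have degr: "card {z\<in>S. T x z} \<le> 2 * s" if "x \<in> Xr" "S \<subseteq> B" for x S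
  proof -
    have "card {z\<in>S. T x z} \<le> card {z\<in>B. T x z}" by (rule card_mono) (use finB that in auto)
    then show ?thesis using that Xr unfolding AR_def by fastforce
  qed
  have degb: "card {z\<in>S. R x z} \<le> 2 * s" if "x \<in> Xb" "S \<subseteq> B" for x S
  proof -
    have "card {z\<in>S. R x z} \<le> card {z\<in>B. R x z}" by (rule card_mono) (use finB that in auto)
    then show ?thesis using that Xb unfolding AT_def by fastforce
  qed
  have "\<exists>D\<subseteq>Xr. card (Xr - D) < m \<and> conn R (D \<union> {z\<in>B1. \<exists>x\<in>D. R x z})"
    by (rule connected_core) (use XA Xr(2) B1 block degr in simp_all)
  then obtain Dr where Dr: "Dr \<subseteq> Xr" "card (Xr - Dr) < m" "conn R (Dr \<union> {z\<in>B1. \<exists>x\<in>Dr. R x z})"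
    by blast
  have "\<exists>D\<subseteq>Xb. card (Xb - D) < m \<and> conn T (D \<union> {z\<in>B2. \<exists>x\<in>D. T x z})"
    by (rule co.connected_core) (use XA Xb(2) B2B B2(2) block degb in simp_all)
  then obtain Db where Db: "Db \<subseteq> Xb" "card (Xb - Db) < m" "conn T (Db \<union> {z\<in>B2. \<exists>x\<in>Db. T x z})"
    by blast
  have cD: "m \<le> card Dr" "m \<le> card Db" "card Dr \<le> 3 * m" "card Db \<le> 3 * m"
    using Dr(1,2) Db(1,2) Xr(2) Xb(2) card_mono[OF XA(2) Dr(1)] card_mono[OF XA(4) Db(1)]
      card_Diff_subset[OF finite_subset[OF Dr(1) XA(2)] Dr(1)] card_Diff_subset[OF finite_subset[OF Db(1) XA(4)] Db(1)]
    by linarith+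
  have DA: "Dr \<subseteq> A" "Db \<subseteq> A" "Dr \<inter> Db = {}" using Dr(1) Db(1) XA Xr(1) Xb(1) by blast+
  define NR where "NR = {z\<in>B. \<exists>x\<in>Dr. R x z}"
  define NT where "NT = {z\<in>B. \<exists>x\<in>Db. T x z}"
  have nR: "32 * card {z\<in>B. \<not> (\<exists>x\<in>Dr. R x z)} < n"
    by (rule nonneighbours) (use Dr(1) XA cD in \<open>auto intro: degr\<close>)
  have nT: "32 * card {z\<in>B. \<not> (\<exists>x\<in>Db. T x z)} < n"
    by (rule co.nonneighbours) (use Db(1) XA cD in \<open>auto intro: degb\<close>)
  \<comment> \<open>Vertices of \<open>S\<close> are joined to each core in the colour of that core
    and lie in neither reserved block, so each of them can be given to either tree.\<close>
  define S where "S = NR \<inter> NT - (B1 \<union> B2)"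
  have SB: "S \<subseteq> B" "finite S" using finB by (auto simp: S_def NR_def)
  have "card B \<le> card ({z\<in>B. \<not> (\<exists>x\<in>Dr. R x z)} \<union> {z\<in>B. \<not> (\<exists>x\<in>Db. T x z)} \<union> B1 \<union> B2 \<union> S)"
    by (rule card_mono) (use finB fB1 fB2 SB in \<open>auto simp: S_def NR_def NT_def\<close>)
  also have "\<dots> \<le> card {z\<in>B. \<not> (\<exists>x\<in>Dr. R x z)} + card {z\<in>B. \<not> (\<exists>x\<in>Db. T x z)} + card B1 + card B2 + card S"
    by (meson add_mono card_Un_le le_refl order_trans)
  finally have cS: "n \<le> 16 * card S"
    using nR nT cardB B1(2) B2(2) num by linarith
  define U0 where "U0 = {x\<in>A - Dr - Db. \<not> L \<le> card {z\<in>S. R x z} \<and> \<not> L \<le> card {z\<in>S. T x z}}"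
  have cU0: "card U0 < m"
  proof (rule few_sparse_vertices[of _ S])
    fix y assume "y \<in> U0"
    then have "card {x\<in>S. R y x} + card {x\<in>S. T y x} \<le> 4 * s" using Ls by (auto simp: U0_def)
    moreover have "{x\<in>S. R y x \<or> T y x} = {x\<in>S. R y x} \<union> {x\<in>S. T y x}" by auto
    ultimately show "card {z\<in>S. R y z \<or> T y z} \<le> 4 * s"
      using card_Un_le[of "{x\<in>S. R y x}" "{x\<in>S. T y x}"] by simp
  qed (use cS SB in \<open>auto simp: U0_def\<close>)
  have "S \<subseteq> A \<union> B" using SB by auto
  from splitting[OF this] obtain P where P: "P \<subseteq> S"
    and PR: "\<And>v. v \<in> A \<union> B \<Longrightarrow> L \<le> card {u\<in>S. R v u} \<Longrightarrow> \<exists>u\<in>P. R v u"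
    and PT: "\<And>v. v \<in> A \<union> B \<Longrightarrow> L \<le> card {u\<in>S. T v u} \<Longrightarrow> \<exists>u\<in>S - P. T v u"
    by blast
  define F where "F = {x\<in>A - Dr - Db. L \<le> card {z\<in>S. R x z} \<and> L \<le> card {z\<in>S. T x z}}"
  define Fr where "Fr = {x\<in>A - Dr - Db. L \<le> card {z\<in>S. R x z} \<and> \<not> L \<le> card {z\<in>S. T x z}}"
  define Fb where "Fb = {x\<in>A - Dr - Db. \<not> L \<le> card {z\<in>S. R x z} \<and> L \<le> card {z\<in>S. T x z}}"
  have FA: "F \<subseteq> A" "Fr \<subseteq> A" "Fb \<subseteq> A" by (auto simp: F_def Fr_def Fb_def)
  have fF: "finite F" "finite Fr" "finite Fb" using FA finA finite_subset by blast+
  have FAB: "F \<subseteq> A \<union> B" "Fr \<subseteq> A \<union> B" "Fb \<subseteq> A \<union> B" using FA by auto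
  from splitting[OF FAB(1)] obtain Q where Q: "Q \<subseteq> F"
    and QR: "\<And>v. v \<in> A \<union> B \<Longrightarrow> L \<le> card {u\<in>F. R v u} \<Longrightarrow> \<exists>u\<in>Q. R v u"
    and QT: "\<And>v. v \<in> A \<union> B \<Longrightarrow> L \<le> card {u\<in>F. T v u} \<Longrightarrow> \<exists>u\<in>F - Q. T v u"
    by blast
  \<comment> \<open>\<open>Qr\<close> stays in the \<open>R\<close>-tree in order to attach vertices
    of \<open>B\<close>. The other half of \<open>Fr\<close> consists of leaves and can be spared
    for the third tree; \<open>Fb\<close> is treated in the same way for \<open>T\<close>.\<close>
  from splitting[OF FAB(2)] obtain Qr where Qr: "Qr \<subseteq> Fr" "card Fr \<le> 2 * card (Fr - Qr)"
    and QrR: "\<And>v. v \<in> A \<union> B \<Longrightarrow> L \<le> card {u\<in>Fr. R v u} \<Longrightarrow> \<exists>u\<in>Qr. R v u"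
    by blast
  from splitting[OF FAB(3)] obtain Qb where Qb: "Qb \<subseteq> Fb" "card Fb \<le> 2 * card (Fb - Qb)"
    and QbT: "\<And>v. v \<in> A \<union> B \<Longrightarrow> L \<le> card {u\<in>Fb. T v u} \<Longrightarrow> \<exists>u\<in>Qb. T v u"
    by blast
  define Vr where "Vr = {v\<in>B - NR - NT. \<exists>u\<in>Q \<union> Qr. R u v}"
  define Vb where "Vb = {v\<in>B - NR - NT - Vr. \<exists>u\<in>(F - Q) \<union> Qb. T u v}"
  define B3 where "B3 = B - NR - NT - Vr - Vb"
  \<comment> \<open>Vertices reached in one colour only go to the tree of that colour. Of those
    reached in both, \<open>B2\<close> and \<open>S - P\<close> go to the \<open>T\<close>-tree and
    all others, among them \<open>B1\<close> and \<open>P\<close>, to the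
    \<open>R\<close>-tree.\<close>
  define Wb where "Wb = (NT \<inter> (B2 \<union> (S - P))) \<union> (NT - NR)"
  define Wr where "Wr = NR - Wb"
  have NW: "NR \<union> NT = Wr \<union> Wb" "Wr \<inter> Wb = {}" "Wr \<subseteq> NR" "Wb \<subseteq> NT"
    by (auto simp: Wr_def Wb_def)
  have PW: "P \<subseteq> Wr" "S - P \<subseteq> Wb" "NR \<inter> B1 \<subseteq> Wr" "NT \<inter> B2 \<subseteq> Wb"
    using P B2 by (auto simp: S_def Wr_def Wb_def)
  have r1: "conn R (Dr \<union> Wr)"
    by (rule conn_attach_subset[OF symR Dr(3)])
       (use B1 PW(3) NW(3) in \<open>auto simp: NR_def\<close>)
  have b1: "conn T (Db \<union> Wb)"
    by (rule conn_attach_subset[OF symT Db(3)])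
       (use B2 PW(4) NW(4) in \<open>auto simp: NT_def\<close>)
  \<comment> \<open>Common end of the three cases below: the third tree \<open>D \<union> Z\<close>,
    of whichever colour, takes from the first two trees only their leaves \<open>Z\<close>.\<close>
  have main: three_cover
    if Z: "Z \<subseteq> (Fr - Qr) \<union> (Fb - Qb)" and D: "D \<subseteq> B3" "card (B3 - D) \<le> 3 * m"
      and c: "conn R (D \<union> Z) \<or> conn T (D \<union> Z)" for Z D
  proof -
    have exR: "\<exists>w\<in>P. R w y" if "y \<in> Q \<union> (Fr - Z)" for y
      using that PR[of y] Q symR FA by (auto simp: F_def Fr_def)
    have r2: "conn R (Dr \<union> Wr \<union> (Q \<union> (Fr - Z)))"
      by (rule conn_attach[OF symR r1]) (use exR PW(1) in blast)+
    have QrZ: "Qr \<subseteq> Fr - Z" "Qb \<subseteq> Fb - Z"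
      using Qr(1) Qb(1) Z by (auto simp: Fr_def Fb_def)
    have r3: "conn R (Dr \<union> Wr \<union> (Q \<union> (Fr - Z)) \<union> Vr)"
      by (rule conn_attach[OF symR r2]) (use QrZ in \<open>auto simp: Vr_def\<close>)
    have exT: "\<exists>w\<in>S - P. T w y" if "y \<in> (F - Q) \<union> (Fb - Z)" for y
    proof -
      have "y \<in> A \<union> B" "L \<le> card {u\<in>S. T y u}" using that FA by (auto simp: F_def Fb_def)
      then show ?thesis using PT symT by blast
    qed
    have b2: "conn T (Db \<union> Wb \<union> ((F - Q) \<union> (Fb - Z)))"
      by (rule conn_attach[OF symT b1]) (use exT PW(2) in blast)+
    have b3: "conn T (Db \<union> Wb \<union> ((F - Q) \<union> (Fb - Z)) \<union> Vb)"
      by (rule conn_attach[OF symT b2]) (use QrZ in \<open>auto simp: Vb_def\<close>)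
    have F4: "A = Dr \<union> Db \<union> U0 \<union> F \<union> Fr \<union> Fb"
      using DA by (auto simp: U0_def F_def Fr_def Fb_def)
    have Fd: "F \<inter> Fr = {}" "F \<inter> Fb = {}" "Fr \<inter> Fb = {}" "F \<inter> Dr = {}" "F \<inter> Db = {}"
      "Fr \<inter> Dr = {}" "Fr \<inter> Db = {}" "Fb \<inter> Dr = {}" "Fb \<inter> Db = {}"
      by (auto simp: F_def Fr_def Fb_def)
    have WB: "Wr \<subseteq> B" "Wb \<subseteq> B" using NW by (auto simp: NR_def NT_def)
    have VB: "Vr \<subseteq> B - NR - NT" "Vb \<subseteq> B - NR - NT - Vr" by (auto simp: Vr_def Vb_def)
    define X1 X2 X3 where "X1 = Dr \<union> (Q \<union> (Fr - Z))" and "X2 = Db \<union> ((F - Q) \<union> (Fb - Z))" and "X3 = Z"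
    define Y1 Y2 Y3 where "Y1 = Wr \<union> Vr" and "Y2 = Wb \<union> Vb" and "Y3 = D"
    have eqs: "Dr \<union> Wr \<union> (Q \<union> (Fr - Z)) \<union> Vr = X1 \<union> Y1"
      "Db \<union> Wb \<union> ((F - Q) \<union> (Fb - Z)) \<union> Vb = X2 \<union> Y2" "D \<union> Z = X3 \<union> Y3"
      by (simp_all add: X1_def X2_def X3_def Y1_def Y2_def Y3_def Un_ac)
    have Z2: "Z \<subseteq> Fr \<union> Fb" using Z by auto
    have FZ: "F \<inter> Z = {}" "Dr \<inter> Z = {}" "Db \<inter> Z = {}" using Z2 Fd by blast+
    have XAs: "X1 \<subseteq> A" "X2 \<subseteq> A" "X3 \<subseteq> A"
      using DA(1,2) FA Q Z2 unfolding X1_def X2_def X3_def by blast+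
    have X13: "X1 \<inter> X3 = {}" "X2 \<inter> X3 = {}"
      using FZ Q unfolding X1_def X2_def X3_def by blast+
    have "Dr \<inter> ((F - Q) \<union> (Fb - Z)) = {}" "Q \<inter> (Db \<union> (F - Q) \<union> (Fb - Z)) = {}"
      "(Fr - Z) \<inter> (Db \<union> (F - Q) \<union> (Fb - Z)) = {}"
      using Fd Q by blast+
    then have X12: "X1 \<inter> X2 = {}"
      using DA(3) unfolding X1_def X2_def by blast
    have YBs: "Y1 \<subseteq> B" "Y2 \<subseteq> B" "Y3 \<subseteq> B"
      using WB VB D(1) unfolding Y1_def Y2_def Y3_def B3_def by blast+
    have Yd: "Y1 \<inter> Y2 = {}" using NW VB unfolding Y1_def Y2_def by blast
    have "B3 \<inter> (NR \<union> NT \<union> Vr \<union> Vb) = {}" by (auto simp: B3_def)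
    then have Yd': "Y1 \<inter> Y3 = {}" "Y2 \<inter> Y3 = {}"
      using NW(3,4) D(1) unfolding Y1_def Y2_def Y3_def by blast+
    have "A - U0 \<subseteq> X1 \<union> X2 \<union> X3" using F4 by (auto simp: X1_def X2_def X3_def)
    moreover have "B - (B3 - D) \<subseteq> Y1 \<union> Y2 \<union> Y3" using NW(1) by (auto simp: Y1_def Y2_def Y3_def B3_def)
    ultimately have cov: "A \<union> B \<subseteq> U0 \<union> (B3 - D) \<union> (X1 \<union> Y1) \<union> (X2 \<union> Y2) \<union> (X3 \<union> Y3)"
      by blast
    have dis: "(X \<union> Y) \<inter> (X' \<union> Y') = {}"
      if "X \<subseteq> A" "X' \<subseteq> A" "Y \<subseteq> B" "Y' \<subseteq> B" "X \<inter> X' = {}" "Y \<inter> Y' = {}" for X X' Y Y'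
      using that disj by blast
    show ?thesis
    proof (rule three_coverI[OF _ _ _ _ _ _ disjI1[OF r3[unfolded eqs]] disjI2[OF b3[unfolded eqs]] c[unfolded eqs] _ cov])
      show "finite (U0 \<union> (B3 - D))" using finA finB by (auto simp: U0_def B3_def)
      show "card (U0 \<union> (B3 - D)) \<le> 8 * m"
        using card_Un_le[of U0 "B3 - D"] D(2) cU0 by linarith
    qed (intro dis XAs X12 X13 YBs Yd Yd' Un_mono)+
  qed
  have B3: "v \<in> A \<union> B" "card {u\<in>F. R v u} < L" "card {u\<in>F. T v u} < L" "card {u\<in>Fr. R v u} < L" "card {u\<in>Fb. T v u} < L"
    if v: "v \<in> B3" for v
  proof -
    have v': "v \<in> A \<union> B" "v \<in> B - NR - NT" "v \<notin> Vr" "v \<notin> Vb" using v by (auto simp: B3_def)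
    then have no: "\<not> (\<exists>u\<in>Q \<union> Qr. R v u)" "\<not> (\<exists>u\<in>(F - Q) \<union> Qb. T v u)"
      using symR symT unfolding Vr_def Vb_def by blast+
    show "v \<in> A \<union> B" by fact
    show "card {u\<in>F. R v u} < L" "card {u\<in>F. T v u} < L" "card {u\<in>Fr. R v u} < L" "card {u\<in>Fb. T v u} < L"
      using no QR[OF v'(1)] QT[OF v'(1)] QrR[OF v'(1)] QbT[OF v'(1)] by (meson UnCI not_le)+
  qed
  have B3B: "B3 \<subseteq> B" by (auto simp: B3_def)
  \<comment> \<open>One of \<open>F\<close>, \<open>Fr\<close>, \<open>Fb\<close> has nearly a third
    of the vertices of \<open>A\<close>, and halving it still leaves \<open>n / 16\<close>. A large
    \<open>F\<close> makes \<open>B3\<close> negligible, since \<open>B3\<close> has few edges of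
    either colour to \<open>F\<close>. Towards \<open>Fb\<close> it has few edges of colour
    \<open>T\<close>, towards \<open>Fr\<close> few of colour \<open>R\<close>, so the opposite
    colour connects it there.\<close>
  consider "n \<le> 16 * card F" | "n \<le> 16 * card (Fb - Qb)" | "n \<le> 16 * card (Fr - Qr)"
  proof -
    have "card A \<le> card (Dr \<union> Db \<union> U0 \<union> F \<union> Fr \<union> Fb)"
      by (rule card_mono) (use finA fF DA finite_subset[OF _ finA] in \<open>auto simp: U0_def F_def Fr_def Fb_def\<close>)
    also have "\<dots> \<le> card Dr + card Db + card U0 + card F + card Fr + card Fb"
      by (meson add_mono card_Un_le le_refl order_trans)
    finally have "n \<le> 7 * m + card F + card Fr + card Fb" using cD cU0 cardA by linarith
    then show thesis using that Qr(2) Qb(2) num by linarith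
  qed
  then show ?thesis
  proof cases
    case 1
    have "card B3 < m"
    proof (rule sw.few_sparse_vertices[of _ F])
      fix y assume y: "y \<in> B3"
      have "{x\<in>F. R y x \<or> T y x} = {x\<in>F. R y x} \<union> {x\<in>F. T y x}" by auto
      then show "card {z\<in>F. R y z \<or> T y z} \<le> 4 * s"
        using card_Un_le[of "{x\<in>F. R y x}" "{x\<in>F. T y x}"] B3[OF y] Ls by simp
    qed (use 1 B3B FA in auto)
    then show ?thesis by (intro main[of "{}" "{}"]) auto
  next
    case 2
    have "\<exists>D\<subseteq>B3. card (B3 - D) \<le> 3 * m \<and> conn R (D \<union> {z\<in>Fb - Qb. \<exists>x\<in>D. R x z})"
    proof (rule sw.connected_core_weak)
      fix x assume x: "x \<in> B3"
      have "card {z\<in>Fb - Qb. T x z} \<le> card {z\<in>Fb. T x z}" by (rule card_mono) (use fF in auto)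
      then show "card {z\<in>Fb - Qb. T x z} \<le> 2 * s" using B3[OF x] Ls by linarith
    qed (use 2 B3B FA in auto)
    then obtain D where "D \<subseteq> B3" "card (B3 - D) \<le> 3 * m" "conn R (D \<union> {z\<in>Fb - Qb. \<exists>x\<in>D. R x z})"
      by blast
    then show ?thesis by (intro main[of "{z\<in>Fb - Qb. \<exists>x\<in>D. R x z}" D]) auto
  next
    case 3
    have "\<exists>D\<subseteq>B3. card (B3 - D) \<le> 3 * m \<and> conn T (D \<union> {z\<in>Fr - Qr. \<exists>x\<in>D. T x z})"
    proof (rule swco.connected_core_weak)
      fix x assume x: "x \<in> B3"
      have "card {z\<in>Fr - Qr. R x z} \<le> card {z\<in>Fr. R x z}" by (rule card_mono) (use fF in auto)
      then show "card {z\<in>Fr - Qr. R x z} \<le> 2 * s" using B3[OF x] Ls by linarith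
    qed (use 3 B3B FA in auto)
    then obtain D where "D \<subseteq> B3" "card (B3 - D) \<le> 3 * m" "conn T (D \<union> {z\<in>Fr - Qr. \<exists>x\<in>D. T x z})"
      by blast
    then show ?thesis by (intro main[of "{z\<in>Fr - Qr. \<exists>x\<in>D. T x z}" D]) auto
  qed
qed

text \<open>
  After deleting the vertices of small degree in \<open>T\<close>, the components of \<open>T\<close> are large on both sides. If there
  are at least four of them, all edges between different ones have colour \<open>R\<close>, and two of them together with
  the union of the others contain an \<open>R\<close>-connected core.
\<close>

lemma three_cover_if_few_sparse:
  assumes a: "card {x\<in>A. card {y\<in>B. T x y} < 2 * s} < 4 * m"
    and b: "card {y\<in>B. card {x\<in>A. T y x} < 2 * s} < 4 * m"
  shows three_cover
proof -
  interpret sw: two_coloured B A R T n m s L by (rule swap_sides)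
  obtain k where block: "n \<le> 16 * k" "16 * k \<le> n + 16" by (rule obtain_block_size)
  note num = numeric block m_pos ms
  define AR where "AR = {x\<in>A. card {y\<in>B. T x y} < 2 * s}"
  define BR where "BR = {y\<in>B. card {x\<in>A. T y x} < 2 * s}"
  have AR: "AR \<subseteq> A" "finite AR" "card AR < 4 * m" and BR: "BR \<subseteq> B" "finite BR" "card BR < 4 * m"
    using a b finA finB by (auto simp: AR_def BR_def)
  define V where "V = (A - AR) \<union> (B - BR)"
  have fV: "finite V" using finA finB by (simp add: V_def)
  define E where "E u v \<longleftrightarrow> u \<in> V \<and> v \<in> V \<and> T u v" for u v
  have symE: "E u v \<Longrightarrow> E v u" for u v using symT by (auto simp: E_def)
  have symEs: "E\<^sup>*\<^sup>* v u" if "E\<^sup>*\<^sup>* u v" for u v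
    using that by (induction rule: rtranclp_induct) (auto intro: converse_rtranclp_into_rtranclp symE)
  define cmp where "cmp x = {y. E\<^sup>*\<^sup>* x y}" for x
  have cmp_V: "cmp x \<subseteq> V" if "x \<in> V" for x
  proof
    fix y assume "y \<in> cmp x"
    then have "E\<^sup>*\<^sup>* x y" by (simp add: cmp_def)
    then show "y \<in> V" using that by (induction rule: rtranclp_induct) (auto simp: E_def)
  qed
  have cmp_conn: "conn T (cmp x)" for x
    unfolding cmp_def by (rule conn_mono[OF conn_component[OF symE]]) (auto simp: E_def)
  have cmp_self: "x \<in> cmp x" for x by (simp add: cmp_def)
  have cmp_eq: "cmp x = cmp y" if "z \<in> cmp x" "z \<in> cmp y" for x y z
    using that symEs unfolding cmp_def mem_Collect_eq set_eq_iff by (meson rtranclp_trans)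
  have cmp_T: "v \<in> cmp x" if "u \<in> cmp x" "u \<in> V" "v \<in> V" "T u v" for u v x
    using that unfolding cmp_def by (auto simp: E_def intro: rtranclp.rtrancl_into_rtrancl)
  define \<C> where "\<C> = cmp ` V"
  have fC: "finite \<C>" using fV by (simp add: \<C>_def)
  have UC: "\<Union>\<C> = V" using cmp_V cmp_self by (auto simp: \<C>_def)
  have CV: "C \<subseteq> V" if "C \<in> \<C>" for C using that UC by blast
  have finC: "finite C" if "C \<in> \<C>" for C using CV[OF that] fV finite_subset by blast
  have dC: "C \<inter> D = {}" if "C \<in> \<C>" "D \<in> \<C>" "C \<noteq> D" for C D
    using that cmp_eq unfolding \<C>_def by blast
  have noT: "\<not> T u v" if "C \<in> \<C>" "u \<in> C" "v \<in> V - C" for C u v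
    using that cmp_T CV unfolding \<C>_def by blast
  \<comment> \<open>A vertex of \<open>C\<close> finds its \<open>T\<close>-neighbours in
    \<open>C\<close>, except for fewer than \<open>4 * m\<close> deleted ones. With
    \<open>7 * m \<le> s\<close>, a core of \<open>C\<close> that misses fewer than \<open>m\<close>
    vertices still has the \<open>s\<close> vertices required by \<open>edge_s\<close>.\<close>
  have bigB: "2 * s \<le> card (C \<inter> B) + 4 * m" if C: "C \<in> \<C>" "x \<in> C \<inter> A" for C x
  proof -
    have x: "x \<in> V" "x \<notin> AR" using C CV[of C] disj BR(1) by (auto simp: V_def)
    have "{y\<in>B. T x y} \<subseteq> (C \<inter> B) \<union> BR"
      using noT[OF C(1)] C(2) by (auto simp: V_def)
    then have "card {y\<in>B. T x y} \<le> card ((C \<inter> B) \<union> BR)"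
      by (rule card_mono[rotated]) (use finC[OF C(1)] BR in auto)
    also have "\<dots> \<le> card (C \<inter> B) + card BR" by (rule card_Un_le)
    finally show ?thesis using x C(2) BR(3) by (auto simp: AR_def)
  qed
  have bigA: "2 * s \<le> card (C \<inter> A) + 4 * m" if C: "C \<in> \<C>" "x \<in> C \<inter> B" for C x
  proof -
    have x: "x \<in> V" "x \<notin> BR" using C CV[of C] disj AR(1) by (auto simp: V_def)
    have "{y\<in>A. T x y} \<subseteq> (C \<inter> A) \<union> AR"
      using noT[OF C(1)] C(2) by (auto simp: V_def)
    then have "card {y\<in>A. T x y} \<le> card ((C \<inter> A) \<union> AR)"
      by (rule card_mono[rotated]) (use finC[OF C(1)] AR in auto)
    also have "\<dots> \<le> card (C \<inter> A) + card AR" by (rule card_Un_le)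
    finally show ?thesis using x C(2) AR(3) by (auto simp: BR_def)
  qed
  have big: "2 * s \<le> card (C \<inter> A) + 4 * m" "2 * s \<le> card (C \<inter> B) + 4 * m" if C: "C \<in> \<C>" for C
  proof -
    have ne: "C \<noteq> {}" using C cmp_self by (auto simp: \<C>_def)
    have "C \<subseteq> A \<union> B" using CV[OF C] by (auto simp: V_def)
    then have *: "C \<inter> A \<noteq> {} \<or> C \<inter> B \<noteq> {}" using ne by blast
    have pos: "S \<noteq> {}" if "2 * s \<le> card S + 4 * m" for S :: "'v set"
      using that num by (cases "S = {}") auto
    have "C \<inter> B \<noteq> {}" if "C \<inter> A \<noteq> {}" using that pos[OF bigB[OF C]] by blast
    moreover have "C \<inter> A \<noteq> {}" if "C \<inter> B \<noteq> {}" using that pos[OF bigA[OF C]] by blast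
    ultimately have "C \<inter> A \<noteq> {}" "C \<inter> B \<noteq> {}" using * by blast+
    then show "2 * s \<le> card (C \<inter> A) + 4 * m" "2 * s \<le> card (C \<inter> B) + 4 * m"
      using bigA[OF C] bigB[OF C] by blast+
  qed
  show ?thesis
  proof (cases "card \<C> \<le> 3")
    case True
    obtain W1 W2 W3 where W: "{W1, W2, W3} \<subseteq> insert {} \<C>" "W1 \<inter> W2 = {}" "W1 \<inter> W3 = {}" "W2 \<inter> W3 = {}"
      "\<Union>\<C> = W1 \<union> W2 \<union> W3"
      by (rule at_most_three[OF fC True dC])
    have cT: "conn T W" if "W \<in> {W1, W2, W3}" for W
      using that W(1) cmp_conn by (auto simp: \<C>_def)
    have "W1 \<union> W2 \<union> W3 \<subseteq> A \<union> B" using W(5) UC by (auto simp: V_def)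
    moreover have "A \<union> B \<subseteq> (AR \<union> BR) \<union> W1 \<union> W2 \<union> W3" using W(5) UC by (auto simp: V_def)
    moreover have "card (AR \<union> BR) \<le> 8 * m" using card_Un_le[of AR BR] AR BR by linarith
    ultimately show ?thesis
      by (intro three_coverI[of W1 W2 W3 "AR \<union> BR"]) (use W cT AR BR in auto)
  next
    case False
    then have ne: "\<C> \<noteq> {}" by auto
    have "\<exists>C\<in>\<C>. \<forall>D\<in>\<C>. card (D \<inter> U) \<le> card (C \<inter> U)" for U
    proof -
      have "Max ((\<lambda>C. card (C \<inter> U)) ` \<C>) \<in> (\<lambda>C. card (C \<inter> U)) ` \<C>" using fC ne by (intro Max_in) auto
      then show ?thesis using fC ne by (metis (no_types, lifting) Max_ge finite_imageI imageE imageI)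
    qed
    then obtain Ca Cb where Ca: "Ca \<in> \<C>" "\<And>D. D \<in> \<C> \<Longrightarrow> card (D \<inter> A) \<le> card (Ca \<inter> A)"
      and Cb: "Cb \<in> \<C>" "\<And>D. D \<in> \<C> \<Longrightarrow> card (D \<inter> B) \<le> card (Cb \<inter> B)"
      by meson
    \<comment> \<open>Four components are what it takes to find \<open>C\<close> and
      \<open>D\<close> other than \<open>Ca\<close> and \<open>Cb\<close>, the largest ones on the
      two sides. As \<open>Ca \<inter> A\<close> outweighs both \<open>C \<inter> A\<close> and
      \<open>D \<inter> A\<close>, omitting \<open>C\<close> and \<open>D\<close> keeps about a
      third of \<open>A\<close>; likewise for \<open>Cb\<close> and \<open>B\<close>.\<close>
    have "card (\<C> - {Ca, Cb}) \<ge> 2"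
      using False fC diff_card_le_card_Diff[of "{Ca, Cb}" \<C>] card_insert_le_m1[of 2 "{Cb}" Ca] by auto
    then obtain \<D> where \<D>: "\<D> \<subseteq> \<C> - {Ca, Cb}" "card \<D> = 2" by (meson obtain_subset_with_card_n)
    then obtain C D where CD: "C \<in> \<C>" "D \<in> \<C>" "C \<noteq> D" "C \<noteq> Ca" "C \<noteq> Cb" "D \<noteq> Ca" "D \<noteq> Cb"
      by (metis card_2_iff Diff_iff insert_iff insert_subset)
    define X1 where "X1 = A - AR - C - D"
    define Y1 where "Y1 = B - BR - C - D"
    have XY: "X1 \<subseteq> A" "Y1 \<subseteq> B" "finite X1" "finite Y1" "X1 \<subseteq> V" "Y1 \<subseteq> V"
      using finA finB by (auto simp: X1_def Y1_def V_def)
    have sub1: "Ca \<inter> A \<subseteq> X1" "Cb \<inter> B \<subseteq> Y1"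
    proof -
      have d: "Ca \<inter> C = {}" "Ca \<inter> D = {}" "Cb \<inter> C = {}" "Cb \<inter> D = {}"
        by (intro dC CD(1,2) Ca(1) Cb(1) not_sym[OF CD(4)] not_sym[OF CD(5)] not_sym[OF CD(6)] not_sym[OF CD(7)])+
      have "Ca \<inter> A \<subseteq> A - AR" "Cb \<inter> B \<subseteq> B - BR"
        using CV[OF Ca(1)] CV[OF Cb(1)] disj AR(1) BR(1) unfolding V_def by blast+
      then show "Ca \<inter> A \<subseteq> X1" "Cb \<inter> B \<subseteq> Y1"
        using d unfolding X1_def Y1_def by blast+
    qed
    have "card A \<le> card (X1 \<union> (C \<inter> A) \<union> (D \<inter> A) \<union> AR)"
      by (rule card_mono) (use XY finA AR in \<open>auto simp: X1_def\<close>)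
    also have "\<dots> \<le> card X1 + card (C \<inter> A) + card (D \<inter> A) + card AR"
      by (meson add_mono card_Un_le le_refl order_trans)
    finally have cX1: "n \<le> 3 * card X1 + 4 * m"
      using AR(3) cardA Ca(2)[OF CD(1)] Ca(2)[OF CD(2)] card_mono[OF XY(3) sub1(1)] by linarith
    have "card B \<le> card (Y1 \<union> (C \<inter> B) \<union> (D \<inter> B) \<union> BR)"
      by (rule card_mono) (use XY finB BR in \<open>auto simp: Y1_def\<close>)
    also have "\<dots> \<le> card Y1 + card (C \<inter> B) + card (D \<inter> B) + card BR"
      by (meson add_mono card_Un_le le_refl order_trans)
    finally have cY1: "n \<le> 3 * card Y1 + 4 * m"
      using BR(3) cardB Cb(2)[OF CD(1)] Cb(2)[OF CD(2)] card_mono[OF XY(4) sub1(2)] by linarith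
    have "k \<le> card X1" "k \<le> card Y1" using cX1 cY1 num by linarith+
    then obtain Xa Ya where Xa: "Xa \<subseteq> X1" "card Xa = k" and Ya: "Ya \<subseteq> Y1" "card Ya = k"
      by (meson obtain_subset_with_card_n)
    have subs: "C \<inter> A \<subseteq> A" "D \<inter> B \<subseteq> B" "Xa \<subseteq> A" "Ya \<subseteq> B" using Xa Ya XY by auto
    have noCY: "card {z\<in>S. T x z} \<le> 2 * s" if "x \<in> C \<inter> A" "S \<subseteq> Y1" for x S
    proof -
      have "{z\<in>S. T x z} = {}" using that noT[OF CD(1)] XY(6) by (auto simp: Y1_def)
      then show ?thesis by (simp only: card.empty zero_le)
    qed
    have noDX: "card {z\<in>S. T x z} \<le> 2 * s" if "x \<in> D \<inter> B" "S \<subseteq> X1" for x S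
    proof -
      have "{z\<in>S. T x z} = {}" using that noT[OF CD(2)] XY(5) by (auto simp: X1_def)
      then show ?thesis by (simp only: card.empty zero_le)
    qed
    have "3 * m \<le> card (C \<inter> A)" "3 * m \<le> card (D \<inter> B)"
      using big(1)[OF CD(1)] big(2)[OF CD(2)] num by linarith+
    have "\<exists>D0\<subseteq>C \<inter> A. card (C \<inter> A - D0) < m \<and> conn R (D0 \<union> {z\<in>Ya. \<exists>x\<in>D0. R x z})"
      by (rule connected_core) (use subs \<open>3 * m \<le> card (C \<inter> A)\<close> Ya block in \<open>auto intro: noCY\<close>)
    then obtain D1 where D1: "D1 \<subseteq> C \<inter> A" "card (C \<inter> A - D1) < m" "conn R (D1 \<union> {z\<in>Ya. \<exists>x\<in>D1. R x z})"
      by blast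
    have "\<exists>D0\<subseteq>D \<inter> B. card (D \<inter> B - D0) < m \<and> conn R (D0 \<union> {z\<in>Xa. \<exists>x\<in>D0. R x z})"
      by (rule sw.connected_core) (use subs \<open>3 * m \<le> card (D \<inter> B)\<close> Xa block in \<open>auto intro: noDX\<close>)
    then obtain D2 where D2: "D2 \<subseteq> D \<inter> B" "card (D \<inter> B - D2) < m" "conn R (D2 \<union> {z\<in>Xa. \<exists>x\<in>D2. R x z})"
      by blast
    have fCD: "finite (C \<inter> A)" "finite (D \<inter> B)" using finA finB by auto
    have cD: "s \<le> card D1" "s \<le> card D2"
      using D1(2) D2(2) big(1)[OF CD(1)] big(2)[OF CD(2)] num
        card_Diff_subset[OF finite_subset[OF D1(1) fCD(1)] D1(1)]
        card_Diff_subset[OF finite_subset[OF D2(1) fCD(2)] D2(1)] by linarith+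
    then obtain x y where xy: "x \<in> D1" "y \<in> D2" "R x y \<or> T x y"
      using edge_s[of D1 D2] D1(1) D2(1) by blast
    \<comment> \<open>An edge between different components of \<open>T\<close> has colour
      \<open>R\<close>, so this edge joins the core built in \<open>C\<close> on side
      \<open>A\<close> to the one built in \<open>D\<close> on side \<open>B\<close>.\<close>
    have "y \<in> V - C" using xy(2) D2(1) CV[OF CD(2)] dC[OF CD(1-3)] by blast
    then have "R x y" using xy noT[OF CD(1), of x y] D1(1) by blast
    define K where "K = (D1 \<union> {z\<in>Ya. \<exists>x\<in>D1. R x z}) \<union> (D2 \<union> {z\<in>Xa. \<exists>x\<in>D2. R x z})"
    have cK: "conn R K" unfolding K_def
      by (rule conn_join[OF symR D1(3) D2(3) _ _ \<open>R x y\<close>]) (use xy in auto)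
    define A1 where "A1 = {x\<in>X1 - Xa. \<exists>y\<in>D2. R y x}"
    define B1 where "B1 = {y\<in>Y1 - Ya. \<exists>x\<in>D1. R x y}"
    have n1: "32 * card {z\<in>Y1. \<not> (\<exists>x\<in>D1. R x z)} < n"
    proof (rule nonneighbours)
      show "card {z\<in>Y1. T y z} \<le> 2 * s" if "y \<in> D1" for y
        using noCY[of y Y1] that D1(1) by auto
    qed (use D1(1) XY cD num in auto)
    have n2: "32 * card {z\<in>X1. \<not> (\<exists>x\<in>D2. R x z)} < n"
    proof (rule sw.nonneighbours)
      show "card {z\<in>X1. T y z} \<le> 2 * s" if "y \<in> D2" for y
        using noDX[of y X1] that D2(1) by auto
    qed (use D2(1) XY cD num in auto)
    have fa: "finite Xa" "finite Ya" using Xa Ya XY finite_subset by auto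
    have "card Y1 \<le> card ({z\<in>Y1. \<not> (\<exists>x\<in>D1. R x z)} \<union> Ya \<union> B1)"
      by (rule card_mono) (use XY fa in \<open>auto simp: B1_def\<close>)
    also have "\<dots> \<le> card {z\<in>Y1. \<not> (\<exists>x\<in>D1. R x z)} + card Ya + card B1"
      by (meson add_mono card_Un_le le_refl order_trans)
    finally have cB1: "n \<le> 8 * card B1" using n1 Ya(2) cY1 num by linarith
    have "card X1 \<le> card ({z\<in>X1. \<not> (\<exists>x\<in>D2. R x z)} \<union> Xa \<union> A1)"
      by (rule card_mono) (use XY fa in \<open>auto simp: A1_def\<close>)
    also have "\<dots> \<le> card {z\<in>X1. \<not> (\<exists>x\<in>D2. R x z)} + card Xa + card A1"
      by (meson add_mono card_Un_le le_refl order_trans)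
    finally have cA1: "n \<le> 8 * card A1" using n2 Xa(2) cX1 num by linarith
    show ?thesis
    proof (rule three_cover_if_core[OF _ cK _ cA1 _ _ cB1])
      show "K \<subseteq> A \<union> B" using D1(1) D2(1) subs by (auto simp: K_def)
      have Kx: "K \<subseteq> (C \<inter> A) \<union> (D \<inter> B) \<union> Xa \<union> Ya" using D1(1) D2(1) by (auto simp: K_def)
      have "X1 \<inter> (C \<union> D \<union> Ya) = {}" "Y1 \<inter> (C \<union> D \<union> Xa) = {}" using subs XY disj
        unfolding X1_def Y1_def by blast+
      then show "A1 \<subseteq> A - K" "B1 \<subseteq> B - K" using Kx XY unfolding A1_def B1_def by blast+
    qed (auto simp: A1_def B1_def K_def)
  qed
qed

lemma three_cover_holds: three_cover
proof -
  interpret sw: two_coloured B A R T n m s L by (rule swap_sides)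
  interpret co: two_coloured A B T R n m s L by (rule swap_colours)
  let ?AR = "card {x\<in>A. card {y\<in>B. T x y} < 2 * s}"
  let ?AT = "card {x\<in>A. card {y\<in>B. R x y} < 2 * s}"
  let ?BR = "card {x\<in>B. card {y\<in>A. T x y} < 2 * s}"
  let ?BT = "card {x\<in>B. card {y\<in>A. R x y} < 2 * s}"
  \<comment> \<open>Either some colour has few sparse vertices on both sides, or each colour has
    many on some side; the choices of sides give the last four cases.\<close>
  consider "?AR < 4 * m" "?BR < 4 * m" | "?AT < 4 * m" "?BT < 4 * m"
    | "4 * m \<le> ?AR" "4 * m \<le> ?AT" | "4 * m \<le> ?BR" "4 * m \<le> ?BT"
    | "4 * m \<le> ?AR" "4 * m \<le> ?BT" | "4 * m \<le> ?AT" "4 * m \<le> ?BR"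
    by linarith
  then show ?thesis
  proof cases
    case 1 then show ?thesis by (rule three_cover_if_few_sparse)
  next
    case 2 then show ?thesis by (intro three_cover_swap_colours co.three_cover_if_few_sparse)
  next
    case 3 then show ?thesis by (rule three_cover_same_side)
  next
    case 4 then show ?thesis by (intro three_cover_swap_sides sw.three_cover_same_side)
  next
    case 5 then show ?thesis by (intro three_cover_opposite_sides) auto
  next
    case 6 then show ?thesis by (intro three_cover_swap_colours co.three_cover_opposite_sides) auto
  qed
qed

end

section \<open>From edge density to disjoint monochromatic trees\<close>

definition dense_between :: "nat \<Rightarrow> (nat \<times> nat \<Rightarrow> bool) \<Rightarrow> nat \<Rightarrow> nat \<Rightarrow> bool" where
  "dense_between n \<omega> a b \<longleftrightarrow> (\<forall>I\<subseteq>{1..n}. \<forall>J\<subseteq>{1..n}. a \<le> card I \<longrightarrow> b \<le> card J \<longrightarrow> (\<exists>i\<in>I. \<exists>j\<in>J. \<omega> (i, j)))"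

lemma dense_between_sum:
  assumes d: "dense_between n \<omega> a b" and X: "X \<subseteq> Inl ` {1..n}" "a \<le> card X" and Y: "Y \<subseteq> Inr ` {1..n}" "b \<le> card Y"
  shows "\<exists>x\<in>X. \<exists>y\<in>Y. {x, y} \<in> edges (bipartite_graph n n \<omega>)"
proof -
  obtain I where I: "I \<subseteq> {1..n}" "X = Inl ` I" using X(1) by (meson subset_imageE)
  obtain J where J: "J \<subseteq> {1..n}" "Y = Inr ` J" using Y(1) by (meson subset_imageE)
  have "card X = card I" "card Y = card J" using I J by (simp_all add: card_image)
  then obtain i j where "i \<in> I" "j \<in> J" "\<omega> (i, j)"
    using d I J X(2) Y(2) unfolding dense_between_def by metis
  then show ?thesis using I J unfolding bipartite_graph_def by force
qed

lemma simple_bipartite_graph: "simple_graph (bipartite_graph n k \<omega>)"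
  unfolding simple_graph_def bipartite_graph_def by fastforce

lemma almost_disjoint_cover_bipartite_graph:
  assumes d: "dense_between n \<omega> s s" "dense_between n \<omega> m b" "dense_between n \<omega> b m" and b: "b = (n + 33) div 34"
    and num: "0 < m" "7 * m \<le> s" "L \<le> s" "2000 * (m * s) \<le> n" "8 * n < 2 ^ L"
    and col: "edge_colouring 2 (bipartite_graph n n \<omega>) \<phi>" and t: "real (8 * m) \<le> t"
  shows "almost_disjoint_cover (bipartite_graph n n \<omega>) \<phi> 3 t"
proof -
  define G where "G = bipartite_graph n n \<omega>"
  define A B :: "(nat + nat) set" where "A = Inl ` {1..n}" and "B = Inr ` {1..n}"
  define R where "R c u v \<longleftrightarrow> {u, v} \<in> edges G \<and> \<phi> {u, v} = c" for c :: nat and u v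
  have VG: "vertices G = A \<union> B" by (simp add: G_def bipartite_graph_def A_def B_def)
  have RT: "R 0 x y \<or> R 1 x y" if "{x, y} \<in> edges G" for x y
  proof -
    have "\<phi> {x, y} < 2" using col that unfolding edge_colouring_def G_def by blast
    then show ?thesis using that by (auto simp: R_def less_2_cases_iff)
  qed
  have edge: "\<exists>x\<in>X. \<exists>y\<in>Y. R 0 x y \<or> R 1 x y"
    if "dense_between n \<omega> a a'" "X \<subseteq> A" "Y \<subseteq> B" "a \<le> card X" "a' \<le> card Y" for a a' X Y
    using dense_between_sum[OF that(1) that(2)[unfolded A_def] that(4) that(3)[unfolded B_def] that(5)] RT
    unfolding G_def by blast
  interpret two_coloured A B "R 0" "R 1" n m s L
  proof
    show "finite A" "finite B" "A \<inter> B = {}" by (auto simp: A_def B_def)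
    show "card A = n" "card B = n" by (simp_all add: A_def B_def card_image)
    show "R 0 x y \<Longrightarrow> R 0 y x" "R 1 x y \<Longrightarrow> R 1 y x" for x y by (simp_all add: R_def insert_commute)
    show "\<exists>x\<in>X. \<exists>y\<in>Y. R 0 x y \<or> R 1 x y" if "X \<subseteq> A" "Y \<subseteq> B" "s \<le> card X" "s \<le> card Y" for X Y
      by (rule edge[OF d(1) that])
    \<comment> \<open>\<open>b\<close> is \<open>n / 34\<close> rounded up, so
      \<open>n \<le> 34 * card Y\<close> is the same as \<open>b \<le> card Y\<close>.\<close>
    show "\<exists>x\<in>X. \<exists>y\<in>Y. R 0 x y \<or> R 1 x y" if "X \<subseteq> A" "Y \<subseteq> B" "m \<le> card X" "n \<le> 34 * card Y" for X Y
      by (rule edge[OF d(2) that(1-3)]) (use that(4) b in linarith)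
    show "\<exists>x\<in>X. \<exists>y\<in>Y. R 0 x y \<or> R 1 x y" if "X \<subseteq> A" "Y \<subseteq> B" "n \<le> 34 * card X" "m \<le> card Y" for X Y
      by (rule edge[OF d(3) that(1,2) _ that(4)]) (use that(3) b in linarith)
  qed (use num in auto)
  obtain W1 W2 W3 where W: "W1 \<inter> W2 = {}" "W1 \<inter> W3 = {}" "W2 \<inter> W3 = {}" "W1 \<union> W2 \<union> W3 \<subseteq> A \<union> B"
    "\<forall>W\<in>{W1, W2, W3}. conn (R 0) W \<or> conn (R 1) W" "card (A \<union> B - (W1 \<union> W2 \<union> W3)) \<le> 8 * m"
    using three_cover_holds unfolding three_cover_def by blast
  have simple: "simple_graph G" unfolding G_def by (rule simple_bipartite_graph)
  have "\<exists>T. mono_tree G \<phi> T \<and> vertices T = W" if "W \<in> {W1, W2, W3} - {{}}" for W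
  proof -
    have "W \<subseteq> vertices G" "W \<noteq> {}" using that W(4) VG by auto
    moreover have "finite W" using \<open>W \<subseteq> vertices G\<close> VG finA finB finite_subset by auto
    moreover have "conn (R 0) W \<or> conn (R 1) W" using that W(5) by blast
    ultimately show ?thesis
      using conn_imp_mono_tree[OF simple, of W \<phi>] unfolding R_def by blast
  qed
  then obtain f where f: "\<And>W. W \<in> {W1, W2, W3} - {{}} \<Longrightarrow> mono_tree G \<phi> (f W) \<and> vertices (f W) = W"
    by metis
  define \<T> where "\<T> = f ` ({W1, W2, W3} - {{}})"
  have "card \<T> \<le> card ({W1, W2, W3} - {{}})" unfolding \<T>_def by (rule card_image_le) simp
  also have "\<dots> \<le> card {W1, W2, W3}" by (rule card_mono) auto
  also have "\<dots> \<le> 3" by (simp add: card_insert_if)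
  finally have c3: "card \<T> \<le> 3" .
  have "(\<Union>T\<in>\<T>. vertices T) = \<Union> ({W1, W2, W3} - {{}})" using f by (auto simp: \<T>_def)
  then have UT: "(\<Union>T\<in>\<T>. vertices T) = W1 \<union> W2 \<union> W3" by auto
  have "pairwise (\<lambda>S T. disjnt (vertices S) (vertices T)) \<T>"
  proof (rule pairwiseI)
    fix S T assume "S \<in> \<T>" "T \<in> \<T>" "S \<noteq> T"
    then obtain V W where "V \<in> {W1, W2, W3} - {{}}" "W \<in> {W1, W2, W3} - {{}}" "S = f V" "T = f W" "V \<noteq> W"
      by (auto simp: \<T>_def)
    moreover from this have "V \<inter> W = {}" using W(1-3) by blast
    ultimately show "disjnt (vertices S) (vertices T)" using f by (simp add: disjnt_def)
  qed
  moreover have "real (card (vertices G - (\<Union>T\<in>\<T>. vertices T))) \<le> t"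
    unfolding UT VG using W(6) t by linarith
  ultimately show ?thesis
    unfolding almost_disjoint_cover_def G_def[symmetric]
    using c3 f by (intro exI[of _ \<T>]) (auto simp: \<T>_def)
qed

section \<open>A colouring that needs four trees\<close>

text \<open>This separates vertices without determining any component: a labelling constant along
  the edges of one colour keeps differently labelled vertices out of a common tree of that
  colour.\<close>

lemma connected_graph_label:
  assumes G: "connected_graph G" and lab: "\<And>u v. {u, v} \<in> edges G \<Longrightarrow> f u = f v"
    and uv: "u \<in> vertices G" "v \<in> vertices G"
  shows "f u = f v"
proof -
  have "\<exists>xs. walk G xs \<and> hd xs = u \<and> last xs = v" using G uv by (simp add: connected_graph_def)
  then obtain xs where xs: "walk G xs" "hd xs = u" "last xs = v" by blast
  have "f (hd xs) = f (last xs)" if "successively (\<lambda>u v. {u, v} \<in> edges G) xs" "xs \<noteq> []" for xs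
    using that
  proof (induction xs rule: induct_list012)
    case (3 x y zs)
    then show ?case using lab[of x y] by simp
  qed auto
  from this[of xs] show ?thesis using xs by (simp add: walk_def)
qed

text \<open>
  In the colouring below, \<open>l0\<close> is constant on the components of colour 0 and \<open>l1\<close> on those of colour 1, and
  both separate \<open>x1\<close>, \<open>x2\<close>, \<open>y1\<close>, \<open>y2\<close>. Each side is divided into the neighbours of \<open>y2\<close> (resp. \<open>x2\<close>) and the rest.
\<close>

lemma four_le_tc:
  assumes x: "x1 \<in> {1..n}" "x2 \<in> {1..n}" "x1 \<noteq> x2" and y: "y1 \<in> {1..n}" "y2 \<in> {1..n}" "y1 \<noteq> y2"
    and nx: "\<And>j. j \<in> {1..n} \<Longrightarrow> \<not> (\<omega> (x1, j) \<and> \<omega> (x2, j))"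
    and ny: "\<And>i. i \<in> {1..n} \<Longrightarrow> \<not> (\<omega> (i, y1) \<and> \<omega> (i, y2))"
    and nadj: "\<And>i j. i \<in> {x1, x2} \<Longrightarrow> j \<in> {y1, y2} \<Longrightarrow> \<not> \<omega> (i, j)"
  shows "4 \<le> tc 2 (bipartite_graph n n \<omega>)"
proof (rule ccontr)
  assume "\<not> ?thesis"
  define G where "G = bipartite_graph n n \<omega>"
  define a where "a i = (if \<omega> (i, y2) then 2 else 1 :: nat)" for i
  define b where "b j = (if \<omega> (x2, j) then 2 else 1 :: nat)" for j
  define l0 :: "nat + nat \<Rightarrow> nat" where
    "l0 = case_sum (\<lambda>i. if i = x1 then 1 else if i = x2 then 2 else a i)
                   (\<lambda>j. if j = y1 then 3 else if j = y2 then 4 else b j)"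
  define l1 :: "nat + nat \<Rightarrow> nat" where
    "l1 = case_sum (\<lambda>i. if i = x1 then 3 else if i = x2 then 4 else a i)
                   (\<lambda>j. if j = y1 then 1 else if j = y2 then 2 else 3 - b j)"
  define \<phi> where "\<phi> e = (if \<exists>u v. e = {u, v} \<and> l0 u = l0 v then 0 else 1 :: nat)" for e
  have \<phi>: "\<phi> {u, v} = (if l0 u = l0 v then 0 else 1)" for u v
    unfolding \<phi>_def by (auto simp: doubleton_eq_iff)
  \<comment> \<open>Edges at \<open>x1\<close> and \<open>x2\<close> agree in \<open>l0\<close>: a
    neighbour of \<open>x1\<close> is not one of \<open>x2\<close>, so \<open>b\<close> is 1 there,
    and it is 2 at neighbours of \<open>x2\<close>. Likewise edges at \<open>y1\<close> and
    \<open>y2\<close> agree in \<open>l1\<close>. For all other edges \<open>a i\<close> and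
    \<open>b j\<close> lie in \<open>{1, 2}\<close>, so \<open>a i\<close> equals \<open>b j\<close>
    or \<open>3 - b j\<close>.\<close>
  have lr: "l0 (Inl i) = l0 (Inr j) \<or> l1 (Inl i) = l1 (Inr j)"
    if "i \<in> {1..n}" "j \<in> {1..n}" "\<omega> (i, j)" for i j
    using nx[OF that(2)] ny[OF that(1)] nadj[of i j] that(3)
    by (auto simp: l0_def l1_def a_def b_def split: if_splits)
  have l01: "l0 u = l0 v \<or> l1 u = l1 v" if e: "{u, v} \<in> edges G" for u v
  proof -
    obtain i j where ij: "i \<in> {1..n}" "j \<in> {1..n}" "\<omega> (i, j)" "{u, v} = {Inl i, Inr j}"
      using e unfolding G_def bipartite_graph_def by auto
    from ij(4) have "u = Inl i \<and> v = Inr j \<or> u = Inr j \<and> v = Inl i" by (simp add: doubleton_eq_iff)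
    then show ?thesis using lr[OF ij(1-3)] by fastforce
  qed
  have fV: "finite (vertices G)" by (simp add: G_def bipartite_graph_def)
  have "edge_colouring 2 G \<phi>" by (auto simp: edge_colouring_def \<phi>_def)
  from tc_cover[OF fV this] obtain \<T> where \<T>: "finite \<T>" "card \<T> \<le> tc 2 G" "\<forall>T\<in>\<T>. mono_tree G \<phi> T"
    "vertices G \<subseteq> (\<Union>T\<in>\<T>. vertices T)"
    unfolding mono_tree_cover_def by blast
  define S where "S = {Inl x1, Inl x2, Inr y1, Inr y2 :: nat + nat}"
  have cS: "card S = 4" using x y by (simp add: S_def)
  have "S \<subseteq> vertices G" using x y by (auto simp: S_def G_def bipartite_graph_def)
  then have "\<forall>v\<in>S. \<exists>T\<in>\<T>. v \<in> vertices T" using \<T>(4) by blast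
  then obtain g where g: "\<And>v. v \<in> S \<Longrightarrow> g v \<in> \<T> \<and> v \<in> vertices (g v)" by metis
  have "\<not> inj_on g S"
  proof
    assume "inj_on g S"
    then have "card S \<le> card \<T>" by (rule card_inj_on_le) (use g \<T> in auto)
    then show False using \<T>(2) cS \<open>\<not> 4 \<le> tc 2 (bipartite_graph n n \<omega>)\<close> by (simp add: G_def)
  qed
  then obtain u v where uv: "u \<in> S" "v \<in> S" "u \<noteq> v" "g u = g v" unfolding inj_on_def by blast
  define T where "T = g u"
  have T: "mono_tree G \<phi> T" "u \<in> vertices T" "v \<in> vertices T" using g uv \<T>(3) unfolding T_def by metis+
  then obtain c where con: "connected_graph T" and ET: "edges T \<subseteq> edges G" and c: "\<forall>e\<in>edges T. \<phi> e = c"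
    by (auto simp: mono_tree_def subgraph_def tree_def)
  have "l0 u = l0 v \<or> l1 u = l1 v"
  proof (cases "c = 0")
    case True
    have "l0 u = l0 v"
    proof (rule connected_graph_label[OF con _ T(2,3)])
      fix u v assume "{u, v} \<in> edges T"
      then have "\<phi> {u, v} = 0" using c True by blast
      then show "l0 u = l0 v" by (simp add: \<phi> split: if_splits)
    qed
    then show ?thesis ..
  next
    case False
    have "l1 u = l1 v"
    proof (rule connected_graph_label[OF con _ T(2,3)])
      fix u v assume e: "{u, v} \<in> edges T"
      then have "\<phi> {u, v} \<noteq> 0" using c False by auto
      then show "l1 u = l1 v" using l01[of u v] e ET by (auto simp: \<phi> split: if_splits)
    qed
    then show ?thesis ..
  qed
  then show False using uv(1-3) x(3) y(3) by (auto simp: S_def l0_def l1_def)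
qed

section \<open>Probability estimates\<close>

text \<open>Restriction to the countable supports makes the product rule for countable sets
  applicable to arbitrary events.\<close>

lemma prob_pair_pmf_Times:
  "measure_pmf.prob (pair_pmf M N) (A \<times> B) = measure_pmf.prob M A * measure_pmf.prob N B"
proof -
  have "measure_pmf.prob (pair_pmf M N) (A \<times> B) = measure_pmf.prob (pair_pmf M N) ((A \<times> B) \<inter> set_pmf (pair_pmf M N))"
    by (rule measure_Int_set_pmf[symmetric])
  also have "(A \<times> B) \<inter> set_pmf (pair_pmf M N) = (A \<inter> set_pmf M) \<times> (B \<inter> set_pmf N)"
    by auto
  also have "measure_pmf.prob (pair_pmf M N) \<dots> =
      measure_pmf.prob M (A \<inter> set_pmf M) * measure_pmf.prob N (B \<inter> set_pmf N)"
    by (intro measure_pmf_prob_product countable_Int2 countable_set_pmf)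
  finally show ?thesis by (simp add: measure_Int_set_pmf)
qed

lemma prob_Pi_pmf_two_blocks:
  assumes U: "finite U" "D \<subseteq> U"
    and P: "\<And>f g. (\<And>x. x \<in> D \<Longrightarrow> f x = g x) \<Longrightarrow> P f \<longleftrightarrow> P g"
    and Q: "\<And>f g. (\<And>x. x \<in> U - D \<Longrightarrow> f x = g x) \<Longrightarrow> Q f \<longleftrightarrow> Q g"
  shows "measure_pmf.prob (Pi_pmf U d p) {f. P f \<and> Q f} =
    measure_pmf.prob (Pi_pmf U d p) {f. P f} * measure_pmf.prob (Pi_pmf U d p) {f. Q f}"
proof -
  define M N where "M = Pi_pmf D d p" and "N = Pi_pmf (U - D) d p"
  have UD: "U = D \<union> (U - D)" using U by blast
  have eq: "measure_pmf.prob (Pi_pmf U d p) {f. P' f \<and> Q' f} =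
      measure_pmf.prob M {f. P' f} * measure_pmf.prob N {f. Q' f}"
    if P': "\<And>f g. (\<And>x. x \<in> D \<Longrightarrow> f x = g x) \<Longrightarrow> P' f \<longleftrightarrow> P' g"
      and Q': "\<And>f g. (\<And>x. x \<in> U - D \<Longrightarrow> f x = g x) \<Longrightarrow> Q' f \<longleftrightarrow> Q' g" for P' Q'
  proof -
    define h where "h = (\<lambda>(f, g) x. if x \<in> D then f x else g x :: 'b)"
    have "Pi_pmf U d p = map_pmf h (pair_pmf M N)"
      unfolding h_def M_def N_def by (subst UD, rule Pi_pmf_union) (use U finite_subset in auto)
    moreover have "h -` {f. P' f \<and> Q' f} = {f. P' f} \<times> {g. Q' g}"
    proof -
      have "P' (h (f, g)) \<longleftrightarrow> P' f" "Q' (h (f, g)) \<longleftrightarrow> Q' g" for f g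
        by (auto simp: h_def intro!: P' Q')
      then show ?thesis by auto
    qed
    ultimately show ?thesis by (simp only: measure_map_pmf prob_pair_pmf_Times)
  qed
  \<comment> \<open>Replacing one event by the trivial one identifies each factor with a probability
    in the full product.\<close>
  show ?thesis
    using eq[of P Q, OF P Q] eq[of P "\<lambda>_. True", OF P] eq[of "\<lambda>_. True" Q, OF _ Q] by simp
qed

lemma prob_Pi_pmf_blocks:
  assumes U: "finite U" and K: "finite K" and D: "\<And>k. k \<in> K \<Longrightarrow> D k \<subseteq> U"
    and dis: "\<And>k l. k \<in> K \<Longrightarrow> l \<in> K \<Longrightarrow> k \<noteq> l \<Longrightarrow> D k \<inter> D l = {}"
    and Q: "\<And>k f g. k \<in> K \<Longrightarrow> (\<And>x. x \<in> D k \<Longrightarrow> f x = g x) \<Longrightarrow> Q k f \<longleftrightarrow> Q k g"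
  shows "measure_pmf.prob (Pi_pmf U d p) {f. \<forall>k\<in>K. Q k f} = (\<Prod>k\<in>K. measure_pmf.prob (Pi_pmf U d p) {f. Q k f})"
  using K D dis Q
proof (induction rule: finite_induct)
  case (insert k K)
  have "measure_pmf.prob (Pi_pmf U d p) {f. \<forall>k\<in>insert k K. Q k f} =
      measure_pmf.prob (Pi_pmf U d p) {f. Q k f \<and> (\<forall>k\<in>K. Q k f)}" by simp
  also have "\<dots> = measure_pmf.prob (Pi_pmf U d p) {f. Q k f} * measure_pmf.prob (Pi_pmf U d p) {f. \<forall>k\<in>K. Q k f}"
  proof (rule prob_Pi_pmf_two_blocks[OF U, of "D k"])
    show "D k \<subseteq> U" using insert.prems(1) by blast
    show "Q k f \<longleftrightarrow> Q k g" if "\<And>x. x \<in> D k \<Longrightarrow> f x = g x" for f g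
      using that insert.prems(3)[of k] by blast
    show "(\<forall>k\<in>K. Q k f) \<longleftrightarrow> (\<forall>k\<in>K. Q k g)" if "\<And>x. x \<in> U - D k \<Longrightarrow> f x = g x" for f g
    proof (rule ball_cong[OF refl])
      fix l assume l: "l \<in> K"
      then have "D l \<subseteq> U - D k" using insert.prems(1)[of l] insert.prems(2)[of l k] insert.hyps by blast
      then show "Q l f \<longleftrightarrow> Q l g" using that insert.prems(3)[of l] l by blast
    qed
  qed
  also have "measure_pmf.prob (Pi_pmf U d p) {f. \<forall>k\<in>K. Q k f} = (\<Prod>k\<in>K. measure_pmf.prob (Pi_pmf U d p) {f. Q k f})"
  proof (rule insert.IH)
    show "D l \<subseteq> U" if "l \<in> K" for l using insert.prems(1)[of l] that by blast
    show "D l \<inter> D l' = {}" if "l \<in> K" "l' \<in> K" "l \<noteq> l'" for l l'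
      using insert.prems(2)[of l l'] that by blast
    show "Q l f \<longleftrightarrow> Q l g" if "l \<in> K" "\<And>x. x \<in> D l \<Longrightarrow> f x = g x" for l f g
      by (rule insert.prems(3)) (use that in auto)
  qed
  finally show ?case using insert.hyps by simp
qed simp

lemma prob_neg:
  fixes M :: "'a pmf"
  shows "measure_pmf.prob M {f. \<not> P f} = 1 - measure_pmf.prob M {f. P f}"
proof -
  have "{f. \<not> P f} = space (measure_pmf M) - {f. P f}" by auto
  then show ?thesis using measure_pmf.prob_compl[of "{f. P f}" M] by simp
qed

section \<open>Events of independent Bernoulli coordinates\<close>

context
  fixes U :: "'a set" and p :: real and M
  assumes U: "finite U" and p: "p \<in> {0..1}"
  defines "M \<equiv> Pi_pmf U False (\<lambda>_. bernoulli_pmf p)"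
begin

lemma prob_coordinate: "x \<in> U \<Longrightarrow> measure_pmf.prob M {f. f x} = p"
proof -
  assume x: "x \<in> U"
  have "map_pmf (\<lambda>f. f x) M = bernoulli_pmf p" using Pi_pmf_component[OF U, of x] x by (simp add: M_def)
  then have "measure_pmf.prob (bernoulli_pmf p) {True} = measure_pmf.prob M ((\<lambda>f. f x) -` {True})"
    by (metis measure_map_pmf)
  moreover have "(\<lambda>f. f x) -` {True} = {f. f x}" by auto
  ultimately show ?thesis using p by (simp add: measure_pmf_single)
qed

lemma prob_no_coordinate:
  assumes "X \<subseteq> U"
  shows "measure_pmf.prob M {f. \<forall>x\<in>X. \<not> f x} = (1 - p) ^ card X"
proof -
  have "measure_pmf.prob M {f. \<forall>x\<in>X. \<not> f x} = (\<Prod>x\<in>X. measure_pmf.prob M {f. \<not> f x})"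
    unfolding M_def by (rule prob_Pi_pmf_blocks[OF U, where D = "\<lambda>x. {x}"])
      (use assms U finite_subset in auto)
  also have "\<dots> = (\<Prod>x\<in>X. 1 - p)"
    by (rule prod.cong) (use assms in \<open>auto simp: prob_neg prob_coordinate\<close>)
  finally show ?thesis by simp
qed

lemma prob_not_both:
  assumes "x \<in> U" "y \<in> U" "x \<noteq> y"
  shows "measure_pmf.prob M {f. \<not> (f x \<and> f y)} = 1 - p\<^sup>2"
proof -
  have "measure_pmf.prob M {f. f x \<and> f y} = measure_pmf.prob M {f. f x} * measure_pmf.prob M {f. f y}"
    unfolding M_def by (rule prob_Pi_pmf_two_blocks[OF U, of "{x}"]) (use assms in auto)
  then show ?thesis using prob_neg[of M "\<lambda>f. f x \<and> f y"] assms by (simp add: prob_coordinate power2_eq_square)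
qed

text \<open>\<open>e i j\<close> encodes the edge between vertex \<open>i\<close> of one side and
  vertex \<open>j\<close> of the other, so that one lemma serves both sides. Independence enters
  twice: over \<open>j\<close> for a fixed pair, and over the pairs \<open>2 * k\<close>,
  \<open>2 * k + 1\<close>, whose edge sets are disjoint.\<close>

lemma prob_common_neighbours:
  assumes J: "finite J" and e: "\<And>i j. i < 2 * h \<Longrightarrow> j \<in> J \<Longrightarrow> e i j \<in> U"
    and inj: "\<And>i j i' j'. e i j = e i' j' \<Longrightarrow> i = i' \<and> j = j'"
  shows "measure_pmf.prob M {f. \<forall>k<h. \<not> (\<forall>j\<in>J. \<not> (f (e (2 * k) j) \<and> f (e (2 * k + 1) j)))} =
    (1 - (1 - p\<^sup>2) ^ card J) ^ h"
proof -
  have ne: "e (2 * k) j \<noteq> e (2 * l + 1) j'" for k l j j'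
  proof
    assume "e (2 * k) j = e (2 * l + 1) j'"
    then have "2 * k = 2 * l + 1" using inj by blast
    then show False by presburger
  qed
  have one: "measure_pmf.prob M {f. \<not> (\<forall>j\<in>J. \<not> (f (e (2 * k) j) \<and> f (e (2 * k + 1) j)))} = 1 - (1 - p\<^sup>2) ^ card J"
    if k: "k < h" for k
  proof -
    have "measure_pmf.prob M {f. \<forall>j\<in>J. \<not> (f (e (2 * k) j) \<and> f (e (2 * k + 1) j))} =
        (\<Prod>j\<in>J. measure_pmf.prob M {f. \<not> (f (e (2 * k) j) \<and> f (e (2 * k + 1) j))})"
      unfolding M_def
    proof (rule prob_Pi_pmf_blocks[OF U J, where D = "\<lambda>j. {e (2 * k) j, e (2 * k + 1) j}"])
      show "{e (2 * k) j, e (2 * k + 1) j} \<subseteq> U" if "j \<in> J" for j using e k that by auto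
      show "{e (2 * k) j, e (2 * k + 1) j} \<inter> {e (2 * k) j', e (2 * k + 1) j'} = {}" if "j \<noteq> j'" for j j'
        using inj[of "2 * k" j "2 * k" j'] inj[of "2 * k + 1" j "2 * k + 1" j'] ne[of k j k j'] ne[of k j' k j] that
        by auto
    qed auto
    also have "\<dots> = (\<Prod>j\<in>J. 1 - p\<^sup>2)"
      by (rule prod.cong[OF refl], rule prob_not_both) (use e k ne in auto)
    finally show ?thesis using prob_neg[of M "\<lambda>f. \<forall>j\<in>J. \<not> (f (e (2 * k) j) \<and> f (e (2 * k + 1) j))"] by simp
  qed
  define D where "D k = e (2 * k) ` J \<union> e (2 * k + 1) ` J" for k
  have "measure_pmf.prob M {f. \<forall>k\<in>{..<h}. \<not> (\<forall>j\<in>J. \<not> (f (e (2 * k) j) \<and> f (e (2 * k + 1) j)))} =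
      (\<Prod>k\<in>{..<h}. measure_pmf.prob M {f. \<not> (\<forall>j\<in>J. \<not> (f (e (2 * k) j) \<and> f (e (2 * k + 1) j)))})"
    unfolding M_def
  proof (rule prob_Pi_pmf_blocks[OF U, where D = D])
    show "D k \<subseteq> U" if "k \<in> {..<h}" for k using that e by (auto simp: D_def)
    show "D k \<inter> D l = {}" if kl: "k \<noteq> l" for k l
    proof (rule ccontr)
      assume "D k \<inter> D l \<noteq> {}"
      then obtain a b j j' where "a \<in> {2 * k, 2 * k + 1}" "b \<in> {2 * l, 2 * l + 1}" "e a j = e b j'"
        unfolding D_def by blast
      then have "a = b" using inj by blast
      with \<open>a \<in> _\<close> \<open>b \<in> _\<close> kl show False by (auto; presburger)
    qed
    show "(\<not> (\<forall>j\<in>J. \<not> (f (e (2 * k) j) \<and> f (e (2 * k + 1) j)))) \<longleftrightarrow> (\<not> (\<forall>j\<in>J. \<not> (g (e (2 * k) j) \<and> g (e (2 * k + 1) j))))"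
      if "\<And>x. x \<in> D k \<Longrightarrow> f x = g x" for k f g
      using that by (auto simp: D_def)
  qed simp
  also have "\<dots> = (\<Prod>k\<in>{..<h}. 1 - (1 - p\<^sup>2) ^ card J)"
    by (rule prod.cong[OF refl], rule one) simp
  finally show ?thesis by (simp add: Ball_def)
qed

end

section \<open>Tail bounds for the random bipartite graph\<close>

abbreviation edge_pmf :: "nat \<Rightarrow> real \<Rightarrow> (nat \<times> nat \<Rightarrow> bool) pmf" where
  "edge_pmf n p \<equiv> Pi_pmf ({1..n} \<times> {1..n}) False (\<lambda>_. bernoulli_pmf p)"

lemma prob_random_bipartite:
  "measure_pmf.prob (random_bipartite n n p) {G. P G} = measure_pmf.prob (edge_pmf n p) {\<omega>. P (bipartite_graph n n \<omega>)}"
  by (simp add: random_bipartite_def vimage_def)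

lemma prob_Un3_le:
  "measure_pmf.prob M (A \<union> (B \<union> C)) \<le> measure_pmf.prob M A + (measure_pmf.prob M B + measure_pmf.prob M C)"
  using measure_Un_le[of A "measure_pmf M" "B \<union> C"] measure_Un_le[of B "measure_pmf M" C] by simp

lemma whpI:
  assumes "\<forall>\<^sub>F n in sequentially. measure_pmf.prob (X n) {x. \<not> P n x} \<le> \<delta> n" "\<delta> \<longlonglongrightarrow> 0"
  shows "whp X P"
proof -
  have eq: "measure_pmf.prob (X n) {x. P n x} = 1 - measure_pmf.prob (X n) {x. \<not> P n x}" for n
    using prob_neg[of "X n" "\<lambda>x. \<not> P n x"] by simp
  have "(\<lambda>n. measure_pmf.prob (X n) {x. \<not> P n x}) \<longlonglongrightarrow> 0"
    by (rule tendsto_sandwich[OF _ assms(1) tendsto_const assms(2)]) simp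
  then have "(\<lambda>n. 1 - measure_pmf.prob (X n) {x. \<not> P n x}) \<longlonglongrightarrow> 1 - 0"
    by (intro tendsto_intros)
  then show ?thesis by (simp add: whp_def eq)
qed

lemma one_minus_power_le_exp:
  fixes p :: real
  assumes "p \<le> 1"
  shows "(1 - p) ^ k \<le> exp (- p * real k)"
proof -
  have "(1 - p) ^ k \<le> exp (- p) ^ k"
    using assms exp_ge_add_one_self[of "- p"] by (intro power_mono) auto
  then show ?thesis by (simp only: exp_of_nat2_mult)
qed

lemma exp_le_one_minus_power:
  fixes x :: real
  assumes "0 \<le> x" "x \<le> 1 / 2"
  shows "exp (- 2 * x * real k) \<le> (1 - x) ^ k"
proof -
  have "x\<^sup>2 \<le> x / 2" using assms mult_mono[of x x x "1 / 2"] by (simp add: power2_eq_square)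
  then have "- 2 * x \<le> ln (1 - x)" using ln_one_minus_pos_lower_bound[OF assms] by linarith
  then have "exp (- 2 * x) \<le> exp (ln (1 - x))" by (simp only: exp_le_cancel_iff)
  also have "\<dots> = 1 - x" using assms by simp
  finally have "exp (- 2 * x) ^ k \<le> (1 - x) ^ k" by (intro power_mono) auto
  then show ?thesis by (simp only: exp_of_nat2_mult)
qed

lemma binomial_le_power: "n choose k \<le> n ^ k"
proof -
  have "(n choose k) * 1 \<le> (n choose k) * fact k" by (intro mult_left_mono) auto
  then show ?thesis using binomial_fact_pow[of n k] by linarith
qed

lemma prob_not_dense_between:
  assumes p: "p \<in> {0..1}"
  shows "measure_pmf.prob (edge_pmf n p) {\<omega>. \<not> dense_between n \<omega> a b} \<le> real (n choose a) * real (n choose b) * (1 - p) ^ (a * b)"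
proof -
  define \<I> where "\<I> k = {I. I \<subseteq> {1..n} \<and> card I = k}" for k
  have fin: "finite (\<I> k)" and card: "card (\<I> k) = n choose k" for k
    using n_subsets[of "{1..n}" k] by (auto simp: \<I>_def)
  define S where "S = (\<lambda>(I, J). {\<omega>. \<forall>x\<in>I \<times> J. \<not> \<omega> x} :: (nat \<times> nat \<Rightarrow> bool) set)"
  have "{\<omega>. \<not> dense_between n \<omega> a b} \<subseteq> (\<Union>IJ\<in>\<I> a \<times> \<I> b. S IJ)"
  proof
    fix \<omega> assume "\<omega> \<in> {\<omega>. \<not> dense_between n \<omega> a b}"
    then obtain I J where IJ: "I \<subseteq> {1..n}" "J \<subseteq> {1..n}" "a \<le> card I" "b \<le> card J"
      "\<forall>i\<in>I. \<forall>j\<in>J. \<not> \<omega> (i, j)" unfolding dense_between_def by auto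
    obtain I' J' where "I' \<subseteq> I" "card I' = a" "J' \<subseteq> J" "card J' = b"
      using obtain_subset_with_card_n[OF IJ(3)] obtain_subset_with_card_n[OF IJ(4)] by metis
    then have "(I', J') \<in> \<I> a \<times> \<I> b" "\<omega> \<in> S (I', J')" using IJ unfolding \<I>_def S_def by blast+
    then show "\<omega> \<in> (\<Union>IJ\<in>\<I> a \<times> \<I> b. S IJ)" by blast
  qed
  then have "measure_pmf.prob (edge_pmf n p) {\<omega>. \<not> dense_between n \<omega> a b} \<le> measure_pmf.prob (edge_pmf n p) (\<Union>IJ\<in>\<I> a \<times> \<I> b. S IJ)"
    by (rule measure_pmf.finite_measure_mono) simp
  also have "\<dots> \<le> (\<Sum>IJ\<in>\<I> a \<times> \<I> b. measure_pmf.prob (edge_pmf n p) (S IJ))"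
    by (rule measure_pmf.finite_measure_subadditive_finite) (use fin in auto)
  also have "\<dots> = (\<Sum>IJ\<in>\<I> a \<times> \<I> b. (1 - p) ^ (a * b))"
  proof (rule sum.cong[OF refl])
    fix IJ assume "IJ \<in> \<I> a \<times> \<I> b"
    then obtain I J where IJ: "IJ = (I, J)" "I \<subseteq> {1..n}" "J \<subseteq> {1..n}" "card I = a" "card J = b"
      by (auto simp: \<I>_def)
    have "measure_pmf.prob (edge_pmf n p) (S IJ) = (1 - p) ^ card (I \<times> J)"
      unfolding IJ(1) S_def prod.case
      by (rule prob_no_coordinate) (use IJ p in auto)
    then show "measure_pmf.prob (edge_pmf n p) (S IJ) = (1 - p) ^ (a * b)"
      using IJ by (simp add: card_cartesian_product)
  qed
  also have "\<dots> = real (n choose a) * real (n choose b) * (1 - p) ^ (a * b)"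
    by (simp add: card_cartesian_product card)
  finally show ?thesis .
qed

text \<open>The first summand is for pairs of sets of size \<open>s\<close>, the second for sizes
  \<open>m\<close> and \<open>b\<close> in either order. The constant 500 serves two purposes:
  \<open>2000 * (m * s) \<le> 200000 * (l / p\<^sup>2)\<close> has to stay below \<open>n\<close>,
  and the exponent \<open>m * l\<close> for choosing the smaller set must be at most
  \<open>sqrt (n * l) / 20\<close>.\<close>

lemma prob_no_cover_le:
  fixes n :: nat and p :: real
  assumes p: "p \<in> {0..1}" "500 * sqrt (ln (real n) / real n) \<le> p" and n: "59 \<le> ln (real n)"
  shows "measure_pmf.prob (random_bipartite n n p)
      {G. \<not> (\<forall>\<phi>. edge_colouring 2 G \<phi> \<longrightarrow> almost_disjoint_cover G \<phi> 3 (200 / p))}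
    \<le> 1 / real n + 2 * exp (sqrt (real n * ln (real n)) / 20 + real n * (25 / 36 - 12 / 17))"
proof -
  define l where "l = ln (real n)"
  have n0: "0 < real n" using n by (cases "n = 0") auto
  have l: "59 \<le> l" using n by (simp add: l_def)
  have "0 < sqrt (l / real n)" using l n0 by simp
  then have p0: "0 < p" using p(2)[folded l_def] by linarith
  have p1: "p \<le> 1" using p(1) by simp
  have ip: "1 \<le> 1 / p" using p0 p1 by simp
  have "(500 * sqrt (l / real n))\<^sup>2 \<le> p\<^sup>2" using p l n0 by (intro power_mono) (auto simp: l_def)
  then have "250000 * (l / real n) \<le> p\<^sup>2" using l n0 by (simp add: power_mult_distrib)
  then have np: "250000 * l \<le> real n * p\<^sup>2" using n0 by (simp add: field_simps)
  then have lp: "250000 * (l / p\<^sup>2) \<le> real n" using p0 by (simp add: field_simps)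
  \<comment> \<open>\<open>m\<close> makes \<open>p * m * b\<close> at least
    \<open>24 * (n / 34) = 12 / 17 * n\<close>, which beats \<open>n * ln 2\<close>, and
    \<open>8 * m \<le> 200 / p\<close>. \<open>s\<close> makes \<open>p * s \<ge> 3 * l\<close>,
    which beats the \<open>2 * l\<close> per vertex for choosing both sets. The 4 in
    \<open>L\<close> provides \<open>2 ^ 4 > 8\<close>.\<close>
  define m where "m = nat \<lceil>24 / p\<rceil>"
  define s where "s = nat \<lceil>3 * (l / p)\<rceil>"
  define L where "L = nat \<lceil>log 2 (real n)\<rceil> + 4"
  define b where "b = (n + 33) div 34"
  have m: "24 / p \<le> real m" "real m \<le> 25 / p"
  proof -
    have "real m = real_of_int \<lceil>24 / p\<rceil>" using p0 by (simp add: m_def)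
    then show "24 / p \<le> real m" "real m \<le> 25 / p" using ceiling_correct[of "24 / p"] ip by linarith+
  qed
  have lip: "l \<le> l / p" using ip l mult_left_mono[of 1 "1 / p" l] by simp
  have s: "3 * (l / p) \<le> real s" "real s \<le> 4 * (l / p)"
  proof -
    have "real s = real_of_int \<lceil>3 * (l / p)\<rceil>" using p0 l by (simp add: s_def)
    then show "3 * (l / p) \<le> real s" "real s \<le> 4 * (l / p)"
      using ceiling_correct[of "3 * (l / p)"] lip l by linarith+
  qed
  have m0: "0 < m" using m(1) p0 by (cases m) (auto simp: field_simps)
  have ms: "7 * m \<le> s"
  proof -
    \<comment> \<open>This comparison, \<open>175 \<le> 3 * l\<close>, accounts for the 59.\<close>
    have "7 * (25 / p) \<le> 3 * (l / p)" using l p0 by (simp add: field_simps)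
    then show ?thesis using m(2) s(1) by linarith
  qed
  have "3 / 2 * l * (2 / 3) \<le> 3 / 2 * l * ln 2"
    by (rule mult_left_mono[OF ln2_ge_two_thirds]) (use l in simp)
  then have "log 2 (real n) \<le> 3 / 2 * l"
    unfolding log_def l_def[symmetric] by (simp add: pos_divide_le_eq)
  moreover have log0: "0 \<le> log 2 (real n)" using l n0 by (simp add: log_def l_def)
  moreover have "real L = real_of_int \<lceil>log 2 (real n)\<rceil> + 4" using log0 by (simp add: L_def)
  ultimately have "real L \<le> 3 * l" using ceiling_correct[of "log 2 (real n)"] l by linarith
  then have Ls: "L \<le> s" using s(1) lip by linarith
  have sn: "2000 * (m * s) \<le> n"
  proof -
    have "real m * real s \<le> 25 / p * (4 * (l / p))" using m s p0 l by (intro mult_mono) auto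
    also have "\<dots> = 100 * (l / p\<^sup>2)" by (simp add: power2_eq_square)
    finally have "real m * real s \<le> 100 * (l / p\<^sup>2)" .
    moreover have "0 \<le> l / p\<^sup>2" using l by simp
    ultimately have "2000 * (real m * real s) \<le> real n" using lp by linarith
    then have "real (2000 * (m * s)) \<le> real n" by simp
    then show ?thesis by (simp only: of_nat_le_iff)
  qed
  have nL: "8 * n < 2 ^ L"
  proof -
    have "real n = 2 powr log 2 (real n)" using n0 by simp
    also have "\<dots> \<le> 2 powr real (nat \<lceil>log 2 (real n)\<rceil>)" by (intro powr_mono) (linarith, simp)
    also have "\<dots> = 2 ^ nat \<lceil>log 2 (real n)\<rceil>" by (simp add: powr_realpow)
    finally have "real n \<le> real (2 ^ nat \<lceil>log 2 (real n)\<rceil>)" by simp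
    then have "n \<le> 2 ^ nat \<lceil>log 2 (real n)\<rceil>" by (simp only: of_nat_le_iff)
    then show ?thesis using n0 by (simp add: L_def power_add)
  qed
  have t: "real (8 * m) \<le> 200 / p" using m(2) by simp
  have pow: "real n ^ k = exp (real k * l)" for k using n0 by (simp add: l_def exp_of_nat_mult)
  have pow2: "(2::real) ^ n = exp (real n * ln 2)" by (simp add: exp_of_nat_mult)
  have bin: "real (n choose k) \<le> real n ^ k" for k
    using binomial_le_power[of n k] by (simp only: of_nat_le_iff flip: of_nat_power)
  have bin2: "real (n choose k) \<le> 2 ^ n" for k
    using of_nat_mono[OF binomial_le_pow2[of n k], where 'a = real] by simp
  let ?prob = "measure_pmf.prob (edge_pmf n p)"
  have "{\<omega>. \<not> (\<forall>\<phi>. edge_colouring 2 (bipartite_graph n n \<omega>) \<phi> \<longrightarrow> almost_disjoint_cover (bipartite_graph n n \<omega>) \<phi> 3 (200 / p))}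
      \<subseteq> {\<omega>. \<not> dense_between n \<omega> s s} \<union> ({\<omega>. \<not> dense_between n \<omega> m b} \<union> {\<omega>. \<not> dense_between n \<omega> b m})"
    using almost_disjoint_cover_bipartite_graph[OF _ _ _ b_def m0 ms Ls sn nL _ t] by blast
  then have "measure_pmf.prob (random_bipartite n n p)
      {G. \<not> (\<forall>\<phi>. edge_colouring 2 G \<phi> \<longrightarrow> almost_disjoint_cover G \<phi> 3 (200 / p))} \<le>
      ?prob ({\<omega>. \<not> dense_between n \<omega> s s} \<union> ({\<omega>. \<not> dense_between n \<omega> m b} \<union> {\<omega>. \<not> dense_between n \<omega> b m}))"
    unfolding prob_random_bipartite by (rule measure_pmf.finite_measure_mono) simp
  also have "\<dots> \<le> ?prob {\<omega>. \<not> dense_between n \<omega> s s} + (?prob {\<omega>. \<not> dense_between n \<omega> m b} + ?prob {\<omega>. \<not> dense_between n \<omega> b m})"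
    by (rule prob_Un3_le)
  also have "?prob {\<omega>. \<not> dense_between n \<omega> s s} \<le> 1 / real n"
  proof -
    have "?prob {\<omega>. \<not> dense_between n \<omega> s s} \<le> real (n choose s) * real (n choose s) * (1 - p) ^ (s * s)"
      by (rule prob_not_dense_between[OF p(1)])
    also have "\<dots> \<le> real n ^ s * real n ^ s * exp (- p * real (s * s))"
      using bin[of s] p1 one_minus_power_le_exp[OF p1, of "s * s"] by (intro mult_mono) auto
    also have "\<dots> = exp (real s * (2 * l - p * real s))"
      unfolding pow exp_add[symmetric] by (simp add: algebra_simps)
    also have "\<dots> \<le> exp (- l)"
    proof -
      have "p * real s \<ge> 3 * l" using s(1) p0 by (simp add: field_simps)
      moreover have "1 \<le> real s" using ms m0 by linarith
      ultimately have "real s * (2 * l - p * real s) \<le> real s * (- l)" by (intro mult_left_mono) auto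
      also have "\<dots> \<le> - l" using \<open>1 \<le> real s\<close> l by simp
      finally show ?thesis by simp
    qed
    also have "\<dots> = 1 / real n" using n0 by (simp add: l_def exp_minus inverse_eq_divide)
    finally show ?thesis .
  qed
  also have "?prob {\<omega>. \<not> dense_between n \<omega> m b} + ?prob {\<omega>. \<not> dense_between n \<omega> b m} \<le>
      2 * exp (sqrt (real n * l) / 20 + real n * (25 / 36 - 12 / 17))"
  proof -
    \<comment> \<open>Choosing the small set contributes only \<open>m * l\<close> to the exponent.
      The linear set is bounded by \<open>2 ^ n\<close>, so the sign of the exponent depends on
      \<open>25 / 36\<close>, an upper bound for \<open>ln 2\<close>, against
      \<open>12 / 17\<close>.\<close>
    have "real (n choose m) * real (n choose b) * (1 - p) ^ (m * b) \<le> real n ^ m * 2 ^ n * exp (- p * real (m * b))"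
      using bin[of m] bin2[of b] p1 one_minus_power_le_exp[OF p1, of "m * b"] by (intro mult_mono) auto
    also have "\<dots> = exp (real m * l + real n * ln 2 - p * real m * real b)"
      unfolding pow pow2 exp_add[symmetric] by (simp add: algebra_simps)
    also have "\<dots> \<le> exp (sqrt (real n * l) / 20 + real n * (25 / 36 - 12 / 17))"
    proof -
      have "p * real m \<ge> 24" using m(1) p0 by (simp add: field_simps)
      moreover have "real b \<ge> real n / 34" unfolding b_def by linarith
      ultimately have "p * real m * real b \<ge> 24 * (real n / 34)" using n0 by (intro mult_mono) auto
      moreover have "real n * ln 2 \<le> real n * (25 / 36)" using ln2_le_25_over_36 by (intro mult_left_mono) auto
      moreover have "real m * l \<le> sqrt (real n * l) / 20"
      proof -
        have sq: "sqrt (l / real n) * sqrt (real n * l) = l"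
          using n0 l by (simp flip: real_sqrt_mult add: power2_eq_square[symmetric])
        have "500 * l = (500 * sqrt (l / real n)) * sqrt (real n * l)" using sq by simp
        also have "\<dots> \<le> p * sqrt (real n * l)" using p(2) n0 l by (intro mult_right_mono) (auto simp: l_def)
        finally have "25 / p * l \<le> sqrt (real n * l) / 20" using p0 by (simp add: field_simps)
        moreover have "real m * l \<le> 25 / p * l" using m(2) l by (intro mult_right_mono) auto
        ultimately show ?thesis by linarith
      qed
      ultimately show ?thesis by simp
    qed
    finally have *: "real (n choose m) * real (n choose b) * (1 - p) ^ (m * b) \<le> exp (sqrt (real n * l) / 20 + real n * (25 / 36 - 12 / 17))" .
    have "?prob {\<omega>. \<not> dense_between n \<omega> m b} \<le> exp (sqrt (real n * l) / 20 + real n * (25 / 36 - 12 / 17))"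
      using prob_not_dense_between[OF p(1), of n m b] * by linarith
    moreover have "?prob {\<omega>. \<not> dense_between n \<omega> b m} \<le> exp (sqrt (real n * l) / 20 + real n * (25 / 36 - 12 / 17))"
      using prob_not_dense_between[OF p(1), of n b m] * by (simp add: mult.commute)
    ultimately show ?thesis by linarith
  qed
  finally show ?thesis by (simp add: l_def)
qed

text \<open>Independence is required only among the \<open>h\<close> disjoint pairs of one side. The
  two sides and the absence of edges in the square \<open>X\<close> are combined by a union bound,
  so their dependence is harmless; Bernoulli's inequality bounds the risk of an edge in
  \<open>X\<close> by \<open>card X * p\<close>.\<close>

lemma prob_tc_less_4_le:
  fixes n h :: nat and p :: real
  assumes p: "p \<in> {0..1}" and h: "2 * h \<le> n"
  shows "measure_pmf.prob (random_bipartite n n p) {G. \<not> 4 \<le> tc 2 G} \<le> real ((2 * h)\<^sup>2) * p + 2 * (1 - (1 - p\<^sup>2) ^ n) ^ h"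
proof -
  let ?prob = "measure_pmf.prob (edge_pmf n p)"
  \<comment> \<open>The shift is due to pairs being counted from 0 and vertices from 1; exchanging
    the coordinates describes the other side.\<close>
  define e f where "e i j = (i + 1, j)" and "f i j = (j, i + 1)" for i j :: nat
  define E where "E g = {\<omega>. \<forall>k<h. \<not> (\<forall>j\<in>{1..n}. \<not> (\<omega> (g (2 * k) j) \<and> \<omega> (g (2 * k + 1) j)))}"
    for g :: "nat \<Rightarrow> nat \<Rightarrow> nat \<times> nat"
  define X where "X = {1..2 * h} \<times> {1..2 * h}"
  have "{\<omega>. \<not> 4 \<le> tc 2 (bipartite_graph n n \<omega>)} \<subseteq> {\<omega>. \<not> (\<forall>x\<in>X. \<not> \<omega> x)} \<union> (E e \<union> E f)"
  proof (rule subsetI, rule ccontr)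
    fix \<omega> assume \<omega>: "\<omega> \<in> {\<omega>. \<not> 4 \<le> tc 2 (bipartite_graph n n \<omega>)}"
      "\<omega> \<notin> {\<omega>. \<not> (\<forall>x\<in>X. \<not> \<omega> x)} \<union> (E e \<union> E f)"
    then have X: "\<forall>x\<in>X. \<not> \<omega> x" by blast
    obtain k l where k: "k < h" "\<And>j. j \<in> {1..n} \<Longrightarrow> \<not> (\<omega> (2 * k + 1, j) \<and> \<omega> (2 * k + 2, j))"
      and l: "l < h" "\<And>i. i \<in> {1..n} \<Longrightarrow> \<not> (\<omega> (i, 2 * l + 1) \<and> \<omega> (i, 2 * l + 2))"
      using \<omega>(2) unfolding E_def e_def f_def by auto
    have "4 \<le> tc 2 (bipartite_graph n n \<omega>)"
      by (rule four_le_tc[of "2 * k + 1" n "2 * k + 2" "2 * l + 1" "2 * l + 2"])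
         (use k l h X in \<open>auto simp: X_def\<close>)
    then show False using \<omega>(1) by simp
  qed
  then have "measure_pmf.prob (random_bipartite n n p) {G. \<not> 4 \<le> tc 2 G} \<le> ?prob ({\<omega>. \<not> (\<forall>x\<in>X. \<not> \<omega> x)} \<union> (E e \<union> E f))"
    unfolding prob_random_bipartite by (rule measure_pmf.finite_measure_mono) simp
  also have "\<dots> \<le> ?prob {\<omega>. \<not> (\<forall>x\<in>X. \<not> \<omega> x)} + (?prob (E e) + ?prob (E f))"
    by (rule prob_Un3_le)
  also have "?prob {\<omega>. \<not> (\<forall>x\<in>X. \<not> \<omega> x)} \<le> real ((2 * h)\<^sup>2) * p"
  proof -
    have "?prob {\<omega>. \<forall>x\<in>X. \<not> \<omega> x} = (1 - p) ^ card X"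
      by (rule prob_no_coordinate) (use p h in \<open>auto simp: X_def\<close>)
    moreover have "card X = (2 * h)\<^sup>2" by (simp add: X_def power2_eq_square)
    ultimately have "?prob {\<omega>. \<not> (\<forall>x\<in>X. \<not> \<omega> x)} = 1 - (1 - p) ^ ((2 * h)\<^sup>2)"
      by (simp only: prob_neg)
    then show ?thesis using Bernoulli_inequality[of "- p" "(2 * h)\<^sup>2"] p by simp
  qed
  also have "?prob (E e) = (1 - (1 - p\<^sup>2) ^ card {1..n}) ^ h"
    unfolding E_def by (rule prob_common_neighbours) (use p h in \<open>auto simp: e_def\<close>)
  also have "?prob (E f) = (1 - (1 - p\<^sup>2) ^ card {1..n}) ^ h"
    unfolding E_def by (rule prob_common_neighbours) (use p h in \<open>auto simp: f_def\<close>)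
  finally show ?thesis by simp
qed

lemma prob_tc_less_4_le_explicit:
  fixes n :: nat and p :: real
  assumes p: "p \<in> {0..1}" "p \<le> 1 / 4 * sqrt (ln (real n) / real n)"
    and n: "2 * real n powr (1 / 5) \<le> real n" "ln (real n) \<le> real n" "1 \<le> n"
  shows "measure_pmf.prob (random_bipartite n n p) {G. \<not> 4 \<le> tc 2 G} \<le>
    real n powr (2 / 5) * sqrt (ln (real n) / real n) + 2 * exp (- ((real n powr (1 / 5) - 1) * real n powr (- (1 / 8))))"
proof -
  define l where "l = ln (real n)"
  define h where "h = nat \<lfloor>real n powr (1 / 5)\<rfloor>"
  have n0: "0 < real n" and l0: "0 \<le> l" using n by (auto simp: l_def)
  have h: "real n powr (1 / 5) - 1 \<le> real h" "real h \<le> real n powr (1 / 5)"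
    unfolding h_def using of_nat_floor[of "real n powr (1 / 5)"] by (linarith, simp)
  then have "real (2 * h) \<le> real n" using n(1) by simp
  then have hn: "2 * h \<le> n" by (simp only: of_nat_le_iff)
  have "p\<^sup>2 \<le> (1 / 4 * sqrt (l / real n))\<^sup>2" using p by (intro power_mono) (auto simp: l_def)
  then have p2: "16 * p\<^sup>2 \<le> l / real n" using l0 n0 by (simp add: power_mult_distrib power_divide)
  moreover have "l / real n \<le> 1" using n(2) n0 by (simp add: l_def)
  ultimately have p2': "p\<^sup>2 \<le> 1 / 2" by linarith
  \<comment> \<open>The exponent is \<open>2 / 16\<close>: the 2 is lost in passing from
    \<open>1 - p\<^sup>2\<close> to an exponential, the 16 comes from the square of
    \<open>c = 1 / 4\<close>.\<close>
  have "real n powr (- (1 / 8)) = exp (- (l / 8))" using n0 by (simp add: powr_def l_def)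
  also have "\<dots> \<le> exp (- 2 * p\<^sup>2 * real n)"
    using p2 n0 by (simp add: field_simps)
  also have "\<dots> \<le> (1 - p\<^sup>2) ^ n" by (rule exp_le_one_minus_power) (use p2' in auto)
  finally have q: "real n powr (- (1 / 8)) \<le> (1 - p\<^sup>2) ^ n" .
  have q1: "(1 - p\<^sup>2) ^ n \<le> 1" using p2' by (intro power_le_one) auto
  have "(1 - (1 - p\<^sup>2) ^ n) ^ h \<le> exp (- ((1 - p\<^sup>2) ^ n) * real h)"
    by (rule one_minus_power_le_exp[OF q1])
  also have "\<dots> \<le> exp (- ((real n powr (1 / 5) - 1) * real n powr (- (1 / 8))))"
  proof -
    have "(real n powr (1 / 5) - 1) * real n powr (- (1 / 8)) \<le> real h * (1 - p\<^sup>2) ^ n"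
      by (intro mult_mono h q) auto
    then show ?thesis by (simp add: mult.commute)
  qed
  finally have t2: "(1 - (1 - p\<^sup>2) ^ n) ^ h \<le> exp (- ((real n powr (1 / 5) - 1) * real n powr (- (1 / 8))))" .
  have "real ((2 * h)\<^sup>2) * p = 4 * (real h)\<^sup>2 * p" by (simp add: power_mult_distrib)
  also have "\<dots> \<le> 4 * (real n powr (1 / 5))\<^sup>2 * (1 / 4 * sqrt (l / real n))"
    using p h by (intro mult_mono power_mono) (auto simp: l_def)
  also have "(real n powr (1 / 5))\<^sup>2 = real n powr (2 / 5)"
    by (simp add: power2_eq_square flip: powr_add)
  finally have t1: "real ((2 * h)\<^sup>2) * p \<le> real n powr (2 / 5) * sqrt (l / real n)" by simp
  show ?thesis
    using prob_tc_less_4_le[OF p(1) hn] t1 t2 unfolding l_def by linarith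
qed

theorem theorem1p4:
  shows "\<exists>c>0. \<exists>C>0. \<forall>p :: nat \<Rightarrow> real. (\<forall>n. p n \<in> {0..1}) \<longrightarrow>
    ((\<forall>\<^sub>F n in sequentially. p n \<le> c * sqrt (ln (real n) / real n)) \<longrightarrow>
       whp (\<lambda>n. random_bipartite n n (p n)) (\<lambda>n G. tc 2 G \<ge> 4)) \<and>
    ((\<forall>\<^sub>F n in sequentially. p n \<ge> C * sqrt (ln (real n) / real n)) \<longrightarrow>
       whp (\<lambda>n. random_bipartite n n (p n))
         (\<lambda>n G. \<forall>\<phi>. edge_colouring 2 G \<phi> \<longrightarrow> almost_disjoint_cover G \<phi> 3 (200 / p n)))"
proof (rule exI[of _ "1 / 4"], rule conjI[OF _ exI[of _ 500]], simp, rule conjI, simp, intro allI impI conjI)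
  fix p :: "nat \<Rightarrow> real"
  assume p: "\<forall>n. p n \<in> {0..1}" and le: "\<forall>\<^sub>F n in sequentially. p n \<le> 1 / 4 * sqrt (ln (real n) / real n)"
  show "whp (\<lambda>n. random_bipartite n n (p n)) (\<lambda>n G. tc 2 G \<ge> 4)"
  proof (rule whpI)
    have "\<forall>\<^sub>F n in sequentially. 2 * real n powr (1 / 5) \<le> real n" "\<forall>\<^sub>F n in sequentially. ln (real n) \<le> real n"
      by real_asymp+
    with le eventually_ge_at_top[of 1] show "\<forall>\<^sub>F n in sequentially.
        measure_pmf.prob (random_bipartite n n (p n)) {G. \<not> 4 \<le> tc 2 G} \<le>
        real n powr (2 / 5) * sqrt (ln (real n) / real n) + 2 * exp (- ((real n powr (1 / 5) - 1) * real n powr (- (1 / 8))))"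
      by eventually_elim (rule prob_tc_less_4_le_explicit, use p in auto)
    show "(\<lambda>n. real n powr (2 / 5) * sqrt (ln (real n) / real n) +
        2 * exp (- ((real n powr (1 / 5) - 1) * real n powr (- (1 / 8))))) \<longlonglongrightarrow> 0"
      by real_asymp
  qed
next
  fix p :: "nat \<Rightarrow> real"
  assume p: "\<forall>n. p n \<in> {0..1}" and le: "\<forall>\<^sub>F n in sequentially. p n \<ge> 500 * sqrt (ln (real n) / real n)"
  show "whp (\<lambda>n. random_bipartite n n (p n))
         (\<lambda>n G. \<forall>\<phi>. edge_colouring 2 G \<phi> \<longrightarrow> almost_disjoint_cover G \<phi> 3 (200 / p n))"
  proof (rule whpI)
    have "\<forall>\<^sub>F n in sequentially. 59 \<le> ln (real n)" by real_asymp
    with le show "\<forall>\<^sub>F n in sequentially. measure_pmf.prob (random_bipartite n n (p n))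
        {G. \<not> (\<forall>\<phi>. edge_colouring 2 G \<phi> \<longrightarrow> almost_disjoint_cover G \<phi> 3 (200 / p n))}
        \<le> 1 / real n + 2 * exp (sqrt (real n * ln (real n)) / 20 + real n * (25 / 36 - 12 / 17))"
      by eventually_elim (rule prob_no_cover_le, use p in auto)
    \<comment> \<open>Since \<open>25 / 36 < 12 / 17\<close>, the linear term of the exponent is
      negative and dominates the square root.\<close>
    show "(\<lambda>n. 1 / real n + 2 * exp (sqrt (real n * ln (real n)) / 20 + real n * (25 / 36 - 12 / 17))) \<longlonglongrightarrow> 0"
      by real_asymp
  qed
qed

end
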